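(* The Hamiltonian systems on $\mathbb R^{6N}$ (with Poisson bracket $\{\cdot,\cdot\}$) generated by $H^x$, $H^y$, $H^t$ are completely integrable in the Liouville sense: $H^x,H^y,H^t$ pairwise Poisson-commute; the $3N$ functions $E_m^{(k)}$ ($k=1,2,3$; $m=0,\dots,N-1$) Poisson-commute pairwise and with each of $H^x,H^y,H^t$ (hence are integrals of motion of all three systems); and these $3N$ functions are functionally independent on a dense open subset of $\mathbb R^{6N}$. Moreover, if $(\Phi_1,\Phi_2,\Phi_3)(x,y,t)$ is a smooth simultaneous solution of the three Hamiltonian systems $$\mathrm{i}\,\phi_{j\alpha,s}=\frac{\partial H^s}{\partial\bar\phi_{j\alpha}},\quad -\mathrm{i}\,\bar\phi_{j\alpha,s}=\frac{\partial H^s}{\partial\phi_{j\alpha}}\qquad(s\in\{x,y,t\}),$$ then $u=\mathrm{i}\langle\Phi_2,\Phi_1\rangle$, $v_1=2|\langle\Phi_3,\Phi_1\rangle|^2$, $v_2=2|\langle\Phi_3,\Phi_2\rangle|^2$ solve the Davey–Stewartson I equation $$-\mathrm{i}u_t=u_{xx}+u_{yy}+2|u|^2u+2(v_1+v_2)u,\qquad v_{1,x}-v_{1,y}=v_{2,x}+v_{2,y}=-(|u|^2)_x .$$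
   Context: Fix $N\ge1$, distinct nonzero real $\lambda_1,\dots,\lambda_N$, $\Lambda=\operatorname{diag}(\lambda_1,\dots,\lambda_N)$. Phase space $\mathbb C^{3N}\cong\mathbb R^{6N}$ with points $(\Phi_1,\Phi_2,\Phi_3)$, $\Phi_j=(\phi_{j1},\dots,\phi_{jN})^T$, real coordinates $\operatorname{Re}\phi_{j\alpha},\operatorname{Im}\phi_{j\alpha}$, Wirtinger derivatives. $\langle V,W\rangle=V^*W$, so $\langle\Phi_i,\Lambda^m\Phi_j\rangle=\sum_\alpha\lambda_\alpha^m\bar\phi_{i\alpha}\phi_{j\alpha}$; $\Omega_j=\langle\Phi_j,\Phi_j\rangle$. Poisson bracket: $\{\xi,\eta\}=-\mathrm{i}\sum_{j,\alpha}\big(\partial_{\phi_{j\alpha}}\xi\,\partial_{\bar\phi_{j\alpha}}\eta-\partial_{\bar\phi_{j\alpha}}\xi\,\partial_{\phi_{j\alpha}}\eta\big)$ (from $\omega=\mathrm{i}\sum d\bar\phi_{j\alpha}\wedge d\phi_{j\alpha}$). $L(\lambda)=C+\sum_\alpha(\lambda-\lambda_\alpha)^{-1}F_\alpha F_\alpha^*$ with $C=\operatorname{diag}(1,-1,0)$, $F_\alpha=(\phi_{1\alpha},\phi_{2\alpha},\phi_{3\alpha})^T$. Define $p_k$ by $\det(\xi I-L(\lambda))=\xi^3-p_1(\lambda)\xi^2+p_2(\lambda)\xi-p_3(\lambda)$ and $E_m^{(k)}$ by $p_k(\lambda)=\sum_{m=-1}^\infty E_m^{(k)}\lambda^{-m-1}$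 for $|\lambda|>\max_\alpha|\lambda_\alpha|$. Hamiltonians: $H^x=-\langle\Phi_1,\Lambda\Phi_1\rangle-\langle\Phi_2,\Lambda\Phi_2\rangle-|\langle\Phi_1,\Phi_3\rangle|^2+|\langle\Phi_2,\Phi_3\rangle|^2$; $H^y=-\langle\Phi_1,\Lambda\Phi_1\rangle+\langle\Phi_2,\Lambda\Phi_2\rangle-|\langle\Phi_1,\Phi_3\rangle|^2-|\langle\Phi_2,\Phi_3\rangle|^2-|\langle\Phi_1,\Phi_2\rangle|^2$; $H^t=2\langle\Phi_1,\Lambda^2\Phi_1\rangle-2\langle\Phi_2,\Lambda^2\Phi_2\rangle+4\operatorname{Re}(\langle\Phi_1,\Phi_3\rangle\langle\Phi_3,\Lambda\Phi_1\rangle)+4\operatorname{Re}(\langle\Phi_2,\Phi_3\rangle\langle\Phi_3,\Lambda\Phi_2\rangle)+4\operatorname{Re}(\langle\Phi_1,\Phi_2\rangle\langle\Phi_2,\Lambda\Phi_1\rangle)+2(\Omega_3-\Omega_1)|\langle\Phi_1,\Phi_3\rangle|^2-2(\Omega_3-\Omega_2)|\langle\Phi_2,\Phi_3\rangle|^2-(\Omega_1-\Omega_2)|\langle\Phi_1,\Phi_2\rangle|^2$. Functional independence means: on a dense open subset of $\mathbb R^{6N}$ the Jacobian of the $3N$ functions with respect to the $6N$ real coordinates has rank $3N$. *)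

theory Defs
  imports "HOL-Analysis.Analysis"
begin

text \<open>Phase space C^{3N}: points z :: complex^'n^3, with z$j$a = phi_{j a}
 (j = 1,2,3 in the numeral type 3, a ranging over the N-element type 'n).
 Lam :: real^'n holds lambda_1..lambda_N.\<close>

definition dd :: "('a::real_normed_vector \<Rightarrow> 'b::real_normed_vector) \<Rightarrow> 'a \<Rightarrow> 'a \<Rightarrow> 'b" where
  "dd f p v = vector_derivative (\<lambda>s::real. f (p + s *\<^sub>R v)) (at 0)"

definition re_dir :: "3 \<Rightarrow> 'n::finite \<Rightarrow> complex^'n^3" where
  "re_dir j a = axis j (axis a 1)"

definition im_dir :: "3 \<Rightarrow> 'n::finite \<Rightarrow> complex^'n^3" where
  "im_dir j a = axis j (axis a \<i>)"

definition dphi :: "(complex^'n^3 \<Rightarrow> complex) \<Rightarrow> complex^'n^3 \<Rightarrow> 3 \<Rightarrow> 'n::finite \<Rightarrow> complex" where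
  "dphi f z j a = (dd f z (re_dir j a) - \<i> * dd f z (im_dir j a)) / 2"

definition dphibar :: "(complex^'n^3 \<Rightarrow> complex) \<Rightarrow> complex^'n^3 \<Rightarrow> 3 \<Rightarrow> 'n::finite \<Rightarrow> complex" where
  "dphibar f z j a = (dd f z (re_dir j a) + \<i> * dd f z (im_dir j a)) / 2"

definition PB :: "(complex^'n^3 \<Rightarrow> complex) \<Rightarrow> (complex^'n^3 \<Rightarrow> complex) \<Rightarrow> complex^'n::finite^3 \<Rightarrow> complex" where
  "PB f g z = - \<i> * (\<Sum>j\<in>UNIV. \<Sum>a\<in>UNIV.
      dphi f z j a * dphibar g z j a - dphibar f z j a * dphi g z j a)"

definition ip :: "real^'n::finite \<Rightarrow> nat \<Rightarrow> complex^'n \<Rightarrow> complex^'n \<Rightarrow> complex" where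
  "ip Lam m V W = (\<Sum>a\<in>UNIV. complex_of_real ((Lam$a) ^ m) * cnj (V$a) * W$a)"

definition Omega :: "real^'n::finite \<Rightarrow> complex^'n^3 \<Rightarrow> 3 \<Rightarrow> complex" where
  "Omega Lam z j = ip Lam 0 (z$j) (z$j)"

definition sqabs :: "complex \<Rightarrow> complex" where
  "sqabs w = complex_of_real ((cmod w)^2)"

definition Hx :: "real^'n::finite \<Rightarrow> complex^'n^3 \<Rightarrow> complex" where
  "Hx Lam z = - ip Lam 1 (z$1) (z$1) - ip Lam 1 (z$2) (z$2)
      - sqabs (ip Lam 0 (z$1) (z$3)) + sqabs (ip Lam 0 (z$2) (z$3))"

definition Hy :: "real^'n::finite \<Rightarrow> complex^'n^3 \<Rightarrow> complex" where
  "Hy Lam z = - ip Lam 1 (z$1) (z$1) + ip Lam 1 (z$2) (z$2)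
      - sqabs (ip Lam 0 (z$1) (z$3)) - sqabs (ip Lam 0 (z$2) (z$3))
      - sqabs (ip Lam 0 (z$1) (z$2))"

definition Ht :: "real^'n::finite \<Rightarrow> complex^'n^3 \<Rightarrow> complex" where
  "Ht Lam z = 2 * ip Lam 2 (z$1) (z$1) - 2 * ip Lam 2 (z$2) (z$2)
      + 4 * complex_of_real (Re (ip Lam 0 (z$1) (z$3) * ip Lam 1 (z$3) (z$1)))
      + 4 * complex_of_real (Re (ip Lam 0 (z$2) (z$3) * ip Lam 1 (z$3) (z$2)))
      + 4 * complex_of_real (Re (ip Lam 0 (z$1) (z$2) * ip Lam 1 (z$2) (z$1)))
      + 2 * (Omega Lam z 3 - Omega Lam z 1) * sqabs (ip Lam 0 (z$1) (z$3))
      - 2 * (Omega Lam z 3 - Omega Lam z 2) * sqabs (ip Lam 0 (z$2) (z$3))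
      - (Omega Lam z 1 - Omega Lam z 2) * sqabs (ip Lam 0 (z$1) (z$2))"

definition Cmat :: "complex^3^3" where
  "Cmat = (\<chi> i j. if i = j then (if i = 1 then 1 else if i = 2 then -1 else 0) else 0)"

definition Lax :: "real^'n::finite \<Rightarrow> complex \<Rightarrow> complex^'n^3 \<Rightarrow> complex^3^3" where
  "Lax Lam lam z = Cmat + (\<chi> i j. \<Sum>a\<in>UNIV. z$i$a * cnj (z$j$a) / (lam - complex_of_real (Lam$a)))"

definition pcoefs :: "real^'n::finite \<Rightarrow> complex \<Rightarrow> complex^'n^3 \<Rightarrow> complex \<times> complex \<times> complex" where
  "pcoefs Lam lam z = (THE (a, b, c). \<forall>xi::complex.
      det (mat xi - Lax Lam lam z) = xi^3 - a * xi^2 + b * xi - c)"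

definition pk :: "real^'n::finite \<Rightarrow> nat \<Rightarrow> complex \<Rightarrow> complex^'n^3 \<Rightarrow> complex" where
  "pk Lam k lam z = (case pcoefs Lam lam z of (a, b, c) \<Rightarrow>
      (if k = 1 then a else if k = 2 then b else c))"

definition Rmax :: "real^'n::finite \<Rightarrow> real" where
  "Rmax Lam = Max (range (\<lambda>a. \<bar>Lam$a\<bar>))"

text \<open>p_k(lam) = sum_{m >= -1} E_m^{(k)} lam^{-m-1} for |lam| > max |lambda_a|;
  the coefficient of lam^{-n} is E_{n-1}, so E_m = c (m+1).\<close>
definition Ecoef :: "real^'n::finite \<Rightarrow> nat \<Rightarrow> nat \<Rightarrow> complex^'n^3 \<Rightarrow> complex" where
  "Ecoef Lam k m z = (THE c :: nat \<Rightarrow> complex. \<forall>lam. Rmax Lam < cmod lam \<longrightarrow>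
      (\<lambda>n. c n / lam ^ n) sums pk Lam k lam z) (m + 1)"

definition idx :: "'n::finite \<Rightarrow> nat" where
  "idx = (SOME f. bij_betw f UNIV {..<CARD('n)})"

definition knum :: "3 \<Rightarrow> nat" where
  "knum i = (if i = 1 then 1 else if i = 2 then 2 else 3)"

definition Emap :: "real^'n::finite \<Rightarrow> complex^'n^3 \<Rightarrow> complex^(3 \<times> 'n)" where
  "Emap Lam z = (\<chi> p. Ecoef Lam (knum (fst p)) (idx (snd p)) z)"

fun Ck :: "nat \<Rightarrow> 'a::real_normed_vector set \<Rightarrow> ('a \<Rightarrow> 'b::real_normed_vector) \<Rightarrow> bool" where
  "Ck 0 U f = continuous_on U f"
| "Ck (Suc k) U f = (\<exists>f'. (\<forall>p\<in>U. (f has_derivative f' p) (at p)) \<and> (\<forall>v. Ck k U (\<lambda>p. f' p v)))"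

definition smooth_on :: "'a::real_normed_vector set \<Rightarrow> ('a \<Rightarrow> 'b::real_normed_vector) \<Rightarrow> bool" where
  "smooth_on U f = (\<forall>k. Ck k U f)"

definition ex :: "real \<times> real \<times> real" where "ex = (1, 0, 0)"
definition ey :: "real \<times> real \<times> real" where "ey = (0, 1, 0)"
definition et :: "real \<times> real \<times> real" where "et = (0, 0, 1)"

definition ham_flow :: "(complex^'n::finite^3 \<Rightarrow> complex) \<Rightarrow> real \<times> real \<times> real \<Rightarrow>
    (real \<times> real \<times> real) set \<Rightarrow> (real \<times> real \<times> real \<Rightarrow> complex^'n^3) \<Rightarrow> bool" where
  "ham_flow H e U F = (\<forall>p\<in>U. \<forall>j a.
      \<i> * dd (\<lambda>q. F q $ j $ a) p e = dphibar H (F p) j a \<and>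
      - \<i> * dd (\<lambda>q. cnj (F q $ j $ a)) p e = dphi H (F p) j a)"

definition DSI :: "(real \<times> real \<times> real) set \<Rightarrow> (real \<times> real \<times> real \<Rightarrow> complex)
    \<Rightarrow> (real \<times> real \<times> real \<Rightarrow> complex) \<Rightarrow> (real \<times> real \<times> real \<Rightarrow> complex) \<Rightarrow> bool" where
  "DSI U u v1 v2 = (\<forall>p\<in>U.
      - \<i> * dd u p et = dd (\<lambda>q. dd u q ex) p ex + dd (\<lambda>q. dd u q ey) p ey
          + 2 * sqabs (u p) * u p + 2 * (v1 p + v2 p) * u p \<and>
      dd v1 p ex - dd v1 p ey = - dd (\<lambda>q. sqabs (u q)) p ex \<and>
      dd v2 p ex + dd v2 p ey = - dd (\<lambda>q. sqabs (u q)) p ex)"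

end

theory Submission
  imports Defs
begin

text \<open>Everything takes place in the algebra of polynomials in the coordinates and their conjugates.
  The weighted moments \<open>\<Sum>a. f a * \<phi>\<^sub>i\<^sub>a * cnj \<phi>\<^sub>j\<^sub>a\<close> close under the bracket, which makes the entries of
  the Lax matrix satisfy a linear r-matrix relation. Hence \<open>{L(\<lambda>), p\<^sub>k(\<mu>)}\<close> is a multiple of
  \<open>[Q, L(\<mu>) - L(\<lambda>)]\<close>, where the transposed gradient \<open>Q\<close> of \<open>p\<^sub>k\<close> commutes with \<open>L(\<mu>)\<close>, and
  \<open>{p\<^sub>j(\<lambda>), p\<^sub>k(\<mu>)} = 0\<close> follows by taking a trace.

  As the residues of \<open>L\<close> have rank one, each \<open>p\<^sub>k\<close> has only simple poles, and \<open>E\<^sub>m\<close> is the power sum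
  \<open>\<Sum>a. \<lambda>\<^sub>a ^ m * R\<^sub>k\<^sub>a\<close> of its residues. By uniqueness of partial fractions the \<open>R\<^sub>k\<^sub>a\<close> commute, and the
  three Hamiltonians are polynomials in the \<open>E\<^sub>m\<close> with \<open>m \<le> 2\<close>.

  Near the origin the \<open>R\<^sub>k\<^sub>a\<close> are, to leading order, independent linear combinations of the
  \<open>cmod \<phi>\<^sub>j\<^sub>a ^ 2\<close>, so by the Vandermonde argument some maximal minor of the Jacobian is a nonzero
  polynomial. Along the flows \<open>d/ds f = {f, H}\<close>, which turns the Davey--Stewartson system into bracket
  identities between moments.\<close>

subsection \<open>Polynomials on phase space and the Poisson bracket\<close>

text \<open>Generated syntactically, so that one induction each yields derivatives, restrictions to
  lines and the Wirtinger form of the differential. Membership discharges the differentiability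
  conditions of the bracket rules.\<close>

inductive phase_poly :: "(complex^'n::finite^3 \<Rightarrow> complex) \<Rightarrow> bool" where
  const: "phase_poly (\<lambda>z. c)"
| coord: "phase_poly (\<lambda>z. z$j$a)"
| cnj_coord: "phase_poly (\<lambda>z. cnj (z$j$a))"
| add: "phase_poly f \<Longrightarrow> phase_poly g \<Longrightarrow> phase_poly (\<lambda>z. f z + g z)"
| mult: "phase_poly f \<Longrightarrow> phase_poly g \<Longrightarrow> phase_poly (\<lambda>z. f z * g z)"

lemma phase_poly_uminus: "phase_poly f \<Longrightarrow> phase_poly (\<lambda>z. - f z)"
  using phase_poly.mult[OF phase_poly.const[of "-1"]] by fastforce

lemma phase_poly_diff: "phase_poly f \<Longrightarrow> phase_poly g \<Longrightarrow> phase_poly (\<lambda>z. f z - g z)"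
  using phase_poly.add[OF _ phase_poly_uminus] by fastforce

lemma phase_poly_divide: "phase_poly f \<Longrightarrow> phase_poly (\<lambda>z. f z / c)"
  using phase_poly.mult[OF _ phase_poly.const[of "inverse c"]] by (simp add: divide_inverse)

lemma phase_poly_sum: "(\<And>i. i \<in> S \<Longrightarrow> phase_poly (f i)) \<Longrightarrow> phase_poly (\<lambda>z. \<Sum>i\<in>S. f i z)"
  by (induction S rule: infinite_finite_induct) (auto intro: phase_poly.intros)

lemma phase_poly_prod: "(\<And>i. i \<in> S \<Longrightarrow> phase_poly (f i)) \<Longrightarrow> phase_poly (\<lambda>z. \<Prod>i\<in>S. f i z)"
  by (induction S rule: infinite_finite_induct) (auto intro: phase_poly.intros)

lemma phase_poly_If: "phase_poly f \<Longrightarrow> phase_poly g \<Longrightarrow> phase_poly (\<lambda>z. if b then f z else g z)"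
  by (cases b) simp_all

lemmas phase_poly_intros [simp, intro] =
  phase_poly.const phase_poly.coord phase_poly.cnj_coord phase_poly.add phase_poly.mult
  phase_poly_uminus phase_poly_diff phase_poly_divide phase_poly_sum phase_poly_prod phase_poly_If

lemma has_derivative_coord:
  "((\<lambda>z::complex^'n::finite^3. z$j$a) has_derivative (\<lambda>v. v$j$a)) (at z)"
  by (intro bounded_linear.has_derivative[OF bounded_linear_vec_nth] has_derivative_ident)

lemma phase_poly_derivative:
  assumes "phase_poly f"
  shows "\<exists>f'. (\<forall>z. (f has_derivative f' z) (at z)) \<and> (\<forall>v. phase_poly (\<lambda>z. f' z v))"
  using assms
proof induction
  case (const c)
  show ?case by (rule exI[of _ "\<lambda>z v. 0"]) auto
next
  case (coord j a)
  show ?case by (rule exI[of _ "\<lambda>z v. v$j$a"]) (auto intro: has_derivative_coord)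
next
  case (cnj_coord j a)
  show ?case
    by (rule exI[of _ "\<lambda>z v. cnj (v$j$a)"]) (auto intro: has_derivative_coord has_derivative_cnj)
next
  case (add f g)
  then obtain f' g' where "\<forall>z. (f has_derivative f' z) (at z)" "\<forall>v. phase_poly (\<lambda>z. f' z v)"
    "\<forall>z. (g has_derivative g' z) (at z)" "\<forall>v. phase_poly (\<lambda>z. g' z v)" by blast
  then show ?case
    by (intro exI[of _ "\<lambda>z v. f' z v + g' z v"]) (auto intro: has_derivative_add)
next
  case (mult f g)
  then obtain f' g' where "\<forall>z. (f has_derivative f' z) (at z)" "\<forall>v. phase_poly (\<lambda>z. f' z v)"
    "\<forall>z. (g has_derivative g' z) (at z)" "\<forall>v. phase_poly (\<lambda>z. g' z v)" by blast
  with mult.hyps show ?case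
    by (intro exI[of _ "\<lambda>z v. f z * g' z v + f' z v * g z"]) (auto intro: has_derivative_mult)
qed

section \<open>Directional derivatives of polynomials\<close>

lemma dd_eq:
  assumes "(f has_derivative f') (at z)"
  shows "dd f z v = f' v"
proof -
  have l: "((\<lambda>s::real. z + s *\<^sub>R v) has_derivative (\<lambda>s. s *\<^sub>R v)) (at 0)"
    by (auto intro!: derivative_eq_intros)
  have "((\<lambda>s::real. f (z + s *\<^sub>R v)) has_derivative (\<lambda>s. f' (s *\<^sub>R v))) (at 0)"
    using has_derivative_compose[OF l, of f f'] assms by simp
  then have "((\<lambda>s::real. f (z + s *\<^sub>R v)) has_vector_derivative f' v) (at 0)"
    using has_derivative_linear[OF assms]
    by (simp add: has_vector_derivative_def linear_cmul)
  then show ?thesis unfolding dd_def by (rule vector_derivative_at)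
qed

lemma phase_poly_has_derivative: "phase_poly f \<Longrightarrow> (f has_derivative dd f z) (at z)"
  using phase_poly_derivative[of f] dd_eq[of f _ z] by (metis ext)

lemma phase_poly_dd: "phase_poly f \<Longrightarrow> phase_poly (\<lambda>z. dd f z v)"
  using phase_poly_derivative[of f] dd_eq[of f] by (metis (no_types, lifting) ext)

lemma dd_coord: "dd (\<lambda>z::complex^'n::finite^3. z$j$a) z v = v$j$a"
  by (rule dd_eq[OF has_derivative_coord])

lemma dd_cnj_coord: "dd (\<lambda>z::complex^'n::finite^3. cnj (z$j$a)) z v = cnj (v$j$a)"
  by (rule dd_eq[OF has_derivative_cnj[OF has_derivative_coord]])

lemma dd_const: "dd (\<lambda>z. c) z v = 0"
  by (rule dd_eq) auto

lemma dd_add: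
  "phase_poly f \<Longrightarrow> phase_poly g \<Longrightarrow> dd (\<lambda>z. f z + g z) z v = dd f z v + dd g z v"
  by (rule dd_eq) (intro has_derivative_add phase_poly_has_derivative)

lemma dd_mult:
  "phase_poly f \<Longrightarrow> phase_poly g \<Longrightarrow> dd (\<lambda>z. f z * g z) z v = f z * dd g z v + dd f z v * g z"
  by (rule dd_eq) (intro has_derivative_mult phase_poly_has_derivative)

text \<open>Unless it vanishes identically, such a restriction has only finitely many zeros; the
  density of the set where the Jacobian minor is nonzero rests on this.\<close>

lemma phase_poly_line:
  assumes "phase_poly f"
  shows "\<exists>p. \<forall>t::real. f (z + t *\<^sub>R v) = poly p (of_real t)"
  using assms
proof induction
  case (const c)
  show ?case by (rule exI[of _ "[:c:]"]) auto
next
  case (coord j a)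
  show ?case by (rule exI[of _ "[:z$j$a, v$j$a:]"]) (auto simp: scaleR_conv_of_real[where 'a=complex])
next
  case (cnj_coord j a)
  show ?case by (rule exI[of _ "[:cnj (z$j$a), cnj (v$j$a):]"]) (auto simp: scaleR_conv_of_real[where 'a=complex])
next
  case (add f g)
  then show ?case by (metis poly_add)
next
  case (mult f g)
  then show ?case by (metis poly_mult)
qed

section \<open>The bracket as an antisymmetric biderivation\<close>

lemma PB_antisym: "PB f g z = - PB g f z"
proof -
  have "(\<Sum>j\<in>UNIV. \<Sum>a\<in>UNIV. dphi f z j a * dphibar g z j a - dphibar f z j a * dphi g z j a) =
     - (\<Sum>j\<in>UNIV. \<Sum>a\<in>UNIV. dphi g z j a * dphibar f z j a - dphibar g z j a * dphi f z j a)"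
    unfolding sum_negf[symmetric] by (intro sum.cong refl) (simp add: algebra_simps)
  then show ?thesis unfolding PB_def by simp
qed

lemma PB_const_left: "PB (\<lambda>z. c) h z = 0"
  by (simp add: PB_def dphi_def dphibar_def dd_const)

lemma Wirtinger_add:
  assumes "phase_poly f" "phase_poly g"
  shows "dphi (\<lambda>z. f z + g z) z j a = dphi f z j a + dphi g z j a"
    and "dphibar (\<lambda>z. f z + g z) z j a = dphibar f z j a + dphibar g z j a"
  using assms by (simp_all add: dphi_def dphibar_def dd_add algebra_simps diff_divide_distrib add_divide_distrib)

lemma Wirtinger_mult:
  assumes "phase_poly f" "phase_poly g"
  shows "dphi (\<lambda>z. f z * g z) z j a = f z * dphi g z j a + g z * dphi f z j a"
    and "dphibar (\<lambda>z. f z * g z) z j a = f z * dphibar g z j a + g z * dphibar f z j a"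
  using assms by (simp_all add: dphi_def dphibar_def dd_mult algebra_simps diff_divide_distrib add_divide_distrib)

lemma PB_add_left:
  assumes "phase_poly f" "phase_poly g"
  shows "PB (\<lambda>z. f z + g z) h z = PB f h z + PB g h z"
  unfolding PB_def Wirtinger_add[OF assms]
  by (simp add: algebra_simps sum.distrib sum_subtractf)

lemma PB_mult_left:
  assumes "phase_poly f" "phase_poly g"
  shows "PB (\<lambda>z. f z * g z) h z = f z * PB g h z + g z * PB f h z"
  unfolding PB_def Wirtinger_mult[OF assms]
  by (simp add: algebra_simps sum.distrib sum_subtractf sum_distrib_left)

lemma PB_uminus_left: "phase_poly f \<Longrightarrow> PB (\<lambda>z. - f z) h z = - PB f h z"
  using PB_mult_left[OF phase_poly.const[of "-1"], of f h z] by (simp add: PB_const_left)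

lemma PB_diff_left:
  "phase_poly f \<Longrightarrow> phase_poly g \<Longrightarrow> PB (\<lambda>z. f z - g z) h z = PB f h z - PB g h z"
  using PB_add_left[of f "\<lambda>z. - g z" h z] by (simp add: PB_uminus_left)

lemma PB_divide_left: "phase_poly f \<Longrightarrow> PB (\<lambda>z. f z / c) h z = PB f h z / c"
  using PB_mult_left[OF phase_poly.const[of "inverse c"], of f h z]
  by (simp add: PB_const_left field_simps)

lemma PB_sum_left:
  "(\<And>i. i \<in> S \<Longrightarrow> phase_poly (f i)) \<Longrightarrow> PB (\<lambda>z. \<Sum>i\<in>S. f i z) h z = (\<Sum>i\<in>S. PB (f i) h z)"
  by (induction S rule: infinite_finite_induct) (auto simp: PB_const_left PB_add_left)

lemmas PB_left = PB_const_left PB_add_left PB_mult_left PB_uminus_left PB_diff_left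
  PB_divide_left PB_sum_left

lemma PB_right:
  shows "PB h (\<lambda>z. c) z = 0"
    and "phase_poly f \<Longrightarrow> phase_poly g \<Longrightarrow> PB h (\<lambda>z. f z + g z) z = PB h f z + PB h g z"
    and "phase_poly f \<Longrightarrow> phase_poly g \<Longrightarrow>
      PB h (\<lambda>z. f z * g z) z = f z * PB h g z + g z * PB h f z"
    and "phase_poly f \<Longrightarrow> PB h (\<lambda>z. - f z) z = - PB h f z"
    and "phase_poly f \<Longrightarrow> phase_poly g \<Longrightarrow> PB h (\<lambda>z. f z - g z) z = PB h f z - PB h g z"
    and "phase_poly f \<Longrightarrow> PB h (\<lambda>z. f z / c) z = PB h f z / c"
    and "(\<And>i. i \<in> S \<Longrightarrow> phase_poly (F i)) \<Longrightarrow>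
      PB h (\<lambda>z. \<Sum>i\<in>S. F i z) z = (\<Sum>i\<in>S. PB h (F i) z)"
  unfolding PB_antisym[of h] by (simp_all add: PB_left sum_negf)

lemma sum_sum_delta:
  "(\<Sum>j\<in>UNIV. \<Sum>a\<in>UNIV. if j = k \<and> a = b then f j a else 0) = f (k::'a::finite) (b::'b::finite)"
  for f :: "_ \<Rightarrow> _ \<Rightarrow> 'c::comm_monoid_add"
proof -
  have "(\<Sum>a\<in>UNIV. if j = k \<and> a = b then f j a else 0) = (if j = k then f j b else 0)" for j
    by (cases "j = k") auto
  then show ?thesis by simp
qed

lemma dphi_coord:
  shows "dphi (\<lambda>z::complex^'n::finite^3. z$k$b) z j a = (if j = k \<and> a = b then 1 else 0)"
    and "dphibar (\<lambda>z::complex^'n::finite^3. z$k$b) z j a = 0"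
    and "dphi (\<lambda>z::complex^'n::finite^3. cnj (z$k$b)) z j a = 0"
    and "dphibar (\<lambda>z::complex^'n::finite^3. cnj (z$k$b)) z j a = (if j = k \<and> a = b then 1 else 0)"
  by (auto simp: dphi_def dphibar_def dd_coord dd_cnj_coord re_dir_def im_dir_def axis_def)

lemma PB_coord:
  shows "PB (\<lambda>z::complex^'n::finite^3. z$k$b) (\<lambda>z. z$j$a) z = 0"
    and "PB (\<lambda>z::complex^'n::finite^3. cnj (z$k$b)) (\<lambda>z. cnj (z$j$a)) z = 0"
    and "PB (\<lambda>z::complex^'n::finite^3. z$k$b) (\<lambda>z. cnj (z$j$a)) z = (if j = k \<and> a = b then -\<i> else 0)"
    and "PB (\<lambda>z::complex^'n::finite^3. cnj (z$k$b)) (\<lambda>z. z$j$a) z = (if j = k \<and> a = b then \<i> else 0)"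
proof -
  have *: "(\<Sum>j'\<in>UNIV. \<Sum>a'\<in>UNIV. (if j' = k \<and> a' = b then 1 else 0) * (if j' = j \<and> a' = a then 1 else 0))
      = (if j = k \<and> a = b then 1 else (0::complex))" for j k :: 3 and a b :: 'n
    using sum_sum_delta[of j a "\<lambda>j' a'. if j' = k \<and> a' = b then 1 else (0::complex)"]
    by (simp add: if_distrib[of "\<lambda>x. _ * x"] cong: if_cong)
  show "PB (\<lambda>z::complex^'n::finite^3. z$k$b) (\<lambda>z. z$j$a) z = 0"
    "PB (\<lambda>z::complex^'n::finite^3. cnj (z$k$b)) (\<lambda>z. cnj (z$j$a)) z = 0"
    "PB (\<lambda>z::complex^'n::finite^3. z$k$b) (\<lambda>z. cnj (z$j$a)) z = (if j = k \<and> a = b then -\<i> else 0)"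
    "PB (\<lambda>z::complex^'n::finite^3. cnj (z$k$b)) (\<lambda>z. z$j$a) z = (if j = k \<and> a = b then \<i> else 0)"
    unfolding PB_def dphi_coord by (simp_all add: sum_negf *)
qed

text \<open>The index order is that of the Lax matrix. With weights lambda_a^m the moment is
  therefore \<open>ip Lam m (z$j) (z$i)\<close>, with the two indices swapped.\<close>

definition moment :: "('n::finite \<Rightarrow> complex) \<Rightarrow> 3 \<Rightarrow> 3 \<Rightarrow> complex^'n^3 \<Rightarrow> complex" where
  "moment f i j z = (\<Sum>a\<in>UNIV. f a * (z$i$a * cnj (z$j$a)))"

lemma phase_poly_moment [simp, intro]: "phase_poly (moment f i j)"
  unfolding moment_def[abs_def] by auto

lemma PB_weighted_sums:
  assumes "\<And>a. phase_poly (q a)" "\<And>b. phase_poly (r b)"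
  shows "PB (\<lambda>z. \<Sum>a\<in>S. f a * q a z) (\<lambda>z. \<Sum>b\<in>T. g b * r b z) z =
    (\<Sum>a\<in>S. f a * (\<Sum>b\<in>T. g b * PB (q a) (r b) z))"
  using assms by (simp add: PB_left PB_right)

text \<open>The products of phi_ia and \<open>cnj\<close> phi_ja at one index \<open>a\<close>
  satisfy the gl(3) relations up to a factor i, and products at different indices commute; hence the
  weights multiply pointwise.\<close>

lemma PB_moment:
  "PB (moment f i j) (moment g k l) z =
    - \<i> * ((if i = l then moment (\<lambda>a. f a * g a) k j z else 0) -
           (if j = k then moment (\<lambda>a. f a * g a) i l z else 0))"
proof -
  have q: "PB (\<lambda>z. z$i$a * cnj (z$j$a)) (\<lambda>z. z$k$b * cnj (z$l$b)) z =
     (if b = a then - \<i> * ((if i = l then z$k$a * cnj (z$j$a) else 0) -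
                     (if j = k then z$i$a * cnj (z$l$a) else 0)) else 0)" for a b
    by (simp add: PB_left PB_right PB_coord algebra_simps)
  have "PB (moment f i j) (moment g k l) z = (\<Sum>a\<in>UNIV. f a * (\<Sum>b\<in>UNIV. g b *
      PB (\<lambda>z. z$i$a * cnj (z$j$a)) (\<lambda>z. z$k$b * cnj (z$l$b)) z))"
    unfolding moment_def[abs_def] by (rule PB_weighted_sums) auto
  also have "\<dots> = (\<Sum>a\<in>UNIV. f a * (g a * (- \<i> * ((if i = l then z$k$a * cnj (z$j$a) else 0) -
                     (if j = k then z$i$a * cnj (z$l$a) else 0)))))"
    unfolding q by (simp add: if_distrib[of "\<lambda>x. _ * x"] cong: if_cong)
  also have "\<dots> = - \<i> * ((if i = l then moment (\<lambda>a. f a * g a) k j z else 0) -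
           (if j = k then moment (\<lambda>a. f a * g a) i l z else 0))"
    unfolding moment_def
    by (auto simp: sum_distrib_left algebra_simps sum_subtractf sum.distrib sum_negf)
  finally show ?thesis .
qed

subsection \<open>Characteristic coefficients of the Lax matrix\<close>

text \<open>The elementary symmetric functions of the eigenvalues; for \<open>k = 2\<close> this is
  the sum of the principal minors of order two.\<close>

definition charc :: "nat \<Rightarrow> complex^3^3 \<Rightarrow> complex" where
  "charc k A = (if k = 1 then trace A
    else if k = 2 then A$1$1 * A$2$2 - A$1$2 * A$2$1 + (A$1$1 * A$3$3 - A$1$3 * A$3$1)
      + (A$2$2 * A$3$3 - A$2$3 * A$3$2)
    else det A)"

text \<open>The transposed gradient of \<^const>\<open>charc\<close>; for the determinant this is the adjugate, written
  with the Cayley--Hamilton formula so that it visibly commutes with its argument.\<close>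
definition charc_grad :: "nat \<Rightarrow> complex^3^3 \<Rightarrow> complex^3^3" where
  "charc_grad k A = (if k = 1 then mat 1
    else if k = 2 then mat (trace A) - A
    else A ** A - mat (trace A) ** A + mat (charc 2 A))"

lemma matrix_diff_ldistrib: "A ** (B - C) = A ** B - A ** C" for A :: "complex^'n^'m"
  by (simp add: vec_eq_iff matrix_matrix_mult_def right_diff_distrib sum_subtractf)

lemma matrix_diff_rdistrib: "(B - C) ** A = B ** A - C ** A" for A :: "complex^'n^'m"
  by (simp add: vec_eq_iff matrix_matrix_mult_def left_diff_distrib sum_subtractf)

lemma matrix_plus_rdistrib: "(B + C) ** A = B ** A + C ** A" for A :: "complex^'n^'m"
  by (simp add: vec_eq_iff matrix_matrix_mult_def distrib_right sum.distrib)

text \<open>Each gradient is a polynomial in \<open>A\<close> with scalar coefficients.\<close>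

lemma charc_grad_commute: "charc_grad k A ** A = A ** charc_grad k A"
proof -
  have "mat c ** B = B ** mat c" for c and B :: "complex^3^3"
    by (simp add: vec_eq_iff matrix_matrix_mult_def mat_def if_distrib if_distribR mult.commute cong: if_cong)
  then have "mat c ** B = B ** mat c" "A ** mat c ** A = A ** A ** mat c" for c and B :: "complex^3^3"
    by (metis matrix_mul_assoc)+
  then show ?thesis
    unfolding charc_grad_def
    by (simp add: matrix_add_ldistrib matrix_plus_rdistrib matrix_diff_ldistrib matrix_diff_rdistrib matrix_mul_assoc)
qed

lemma charpoly_coeffs:
  fixes A :: "complex^3^3"
  shows "det (mat xi - A) = xi^3 - charc 1 A * xi^2 + charc 2 A * xi - charc 3 A"
  by (simp add: det_3 charc_def trace_def sum_3 mat_def field_simps power3_eq_cube power2_eq_square)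

lemma pk_eq_charc: "pk Lam k lam z = charc k (Lax Lam lam z)"
proof -
  let ?A = "Lax Lam lam z"
  have "pcoefs Lam lam z = (charc 1 ?A, charc 2 ?A, charc 3 ?A)"
    unfolding pcoefs_def
  proof (rule the_equality, goal_cases)
    case 1
    then show ?case by (simp add: charpoly_coeffs)
  next
    case (2 abc)
    obtain a b c where [simp]: "abc = (a, b, c)" by (cases abc)
    have *: "xi^3 - charc 1 ?A * xi^2 + charc 2 ?A * xi - charc 3 ?A = xi^3 - a * xi^2 + b * xi - c"
      for xi using 2 by (simp add: charpoly_coeffs)
    \<comment> \<open>The values at 0, 1 and -1 determine the three unknown coefficients.\<close>
    from *[of 0] *[of 1] *[of "-1"] show ?case by (auto simp: complex_eq_iff)
  qed
  then show ?thesis by (simp add: pk_def charc_def)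
qed

text \<open>Chain rule for the derivation \<open>PB _ h z\<close>. The swapped indices
  \<open>$ j $ i\<close> make the double sum the trace of the transposed gradient times the matrix
  of brackets.\<close>

lemma PB_charc_left:
  assumes "\<And>i j. phase_poly (\<lambda>z. A z $ i $ j)"
  shows "PB (\<lambda>z. charc k (A z)) h z =
    (\<Sum>i\<in>UNIV. \<Sum>j\<in>UNIV. charc_grad k (A z) $ j $ i * PB (\<lambda>z. A z $ i $ j) h z)"
proof -
  consider "k = 1" | "k = 2" | "k \<noteq> 1" "k \<noteq> 2" by auto
  then show ?thesis
  proof cases
    case 1
    then show ?thesis
      by (simp add: charc_def charc_grad_def trace_def sum_3 PB_left assms mat_def)
  next
    case 2
    then show ?thesis
      by (simp add: charc_def charc_grad_def trace_def sum_3 PB_left assms mat_def algebra_simps)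
  next
    case 3
    have m: "(mat c ** B) $ i $ j = c * B $ i $ j" for c i j and B :: "complex^3^3"
      by (simp add: matrix_matrix_mult_def mat_def if_distrib if_distribR cong: if_cong)
    from 3 show ?thesis
      by (simp add: charc_def charc_grad_def trace_def det_3 sum_3 PB_left assms m)
        (simp add: matrix_matrix_mult_def sum_3 mat_def algebra_simps)
  qed
qed

lemma PB_charc_right:
  assumes "\<And>i j. phase_poly (\<lambda>z. A z $ i $ j)"
  shows "PB h (\<lambda>z. charc k (A z)) z =
    (\<Sum>i\<in>UNIV. \<Sum>j\<in>UNIV. charc_grad k (A z) $ j $ i * PB h (\<lambda>z. A z $ i $ j) z)"
  unfolding PB_antisym[of h] PB_charc_left[OF assms] by (simp add: sum_negf)

section \<open>The r-matrix relation and involution of the characteristic coefficients\<close>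

lemma Lax_nth:
  "Lax Lam lam z $ i $ j = Cmat $ i $ j + moment (\<lambda>a. 1 / (lam - of_real (Lam$a))) i j z"
  by (simp add: Lax_def moment_def)

lemma phase_poly_Lax [simp, intro]: "phase_poly (\<lambda>z. Lax Lam lam z $ i $ j)"
  unfolding Lax_nth by auto

text \<open>The product of the two pole weights splits into their difference over
  \<open>lam - mu\<close>, so the bracket is again linear in Lax matrices; \<open>Cmat\<close>
  cancels in that difference.\<close>

lemma PB_Lax:
  fixes Lam :: "real^'n::finite"
  assumes "lam \<notin> range (\<lambda>a. of_real (Lam$a))" "mu \<notin> range (\<lambda>a. of_real (Lam$a))" "lam \<noteq> mu"
  shows "PB (\<lambda>z. Lax Lam lam z $ i $ j) (\<lambda>z. Lax Lam mu z $ k $ l) z =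
    - \<i> / (lam - mu) * ((if i = l then (Lax Lam mu z - Lax Lam lam z) $ k $ j else 0) -
      (if j = k then (Lax Lam mu z - Lax Lam lam z) $ i $ l else 0))"
proof -
  have "1 / (lam - of_real (Lam$a)) * (1 / (mu - of_real (Lam$a)))
      = (1 / (mu - of_real (Lam$a)) - 1 / (lam - of_real (Lam$a))) / (lam - mu)" for a
    using assms by (auto simp: divide_simps)
  then have "moment (\<lambda>a. 1 / (lam - of_real (Lam$a)) * (1 / (mu - of_real (Lam$a)))) i j z =
      (Lax Lam mu z - Lax Lam lam z) $ i $ j / (lam - mu)" for i j z
    by (simp add: Lax_nth moment_def sum_subtractf left_diff_distrib diff_divide_distrib sum_divide_distrib
      del: divide_divide_eq_left)
  note m = this
  show ?thesis
    unfolding Lax_nth PB_add_left[OF phase_poly.const phase_poly_moment]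
      PB_right(2)[OF phase_poly.const phase_poly_moment] PB_const_left PB_right(1) PB_moment m
    unfolding Lax_nth[symmetric]
    by (simp add: diff_divide_distrib right_diff_distrib)
qed

text \<open>\<open>Q\<close> commutes with \<open>M\<close>, so only the commutator of
  \<open>Q\<close> with \<open>L\<close> is left; cyclicity of the trace moves it onto
  \<open>P\<close> and \<open>L\<close>, which commute.\<close>

lemma trace_commutator_eq_0:
  fixes P Q L M :: "complex^3^3"
  assumes "P ** L = L ** P" "Q ** M = M ** Q"
  shows "trace (P ** (Q ** (M - L) - (M - L) ** Q)) = 0"
proof -
  have "trace (P ** (Q ** L)) = trace (P ** (L ** Q))"
  proof -
    have "trace (P ** (Q ** L)) = trace (L ** (P ** Q))"
      by (metis matrix_mul_assoc trace_mul_sym)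
    then show ?thesis by (metis assms(1) matrix_mul_assoc)
  qed
  then show ?thesis
    by (simp add: matrix_diff_ldistrib matrix_diff_rdistrib trace_sub assms(2))
qed

lemma PB_charc_Lax:
  fixes Lam :: "real^'n::finite"
  assumes "lam \<notin> range (\<lambda>a. of_real (Lam$a))" "mu \<notin> range (\<lambda>a. of_real (Lam$a))" "lam \<noteq> mu"
  shows "PB (\<lambda>z. charc k (Lax Lam lam z)) (\<lambda>z. charc k' (Lax Lam mu z)) z = 0"
proof -
  define L M where "L = Lax Lam lam z" and "M = Lax Lam mu z"
  define P Q where "P = charc_grad k L" and "Q = charc_grad k' M"
  define s where "s = - \<i> / (lam - mu)"
  \<comment> \<open>Contraction with \<open>Q\<close> turns the two Kronecker deltas of the r-matrix
    relation into the two products of a commutator.\<close>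
  have 1: "PB (\<lambda>z. Lax Lam lam z $ i $ j) (\<lambda>z. charc k' (Lax Lam mu z)) z =
      s * (Q ** (M - L) - (M - L) ** Q) $ i $ j" for i j
    unfolding PB_charc_right[OF phase_poly_Lax] PB_Lax[OF assms]
      L_def[symmetric] M_def[symmetric] Q_def[symmetric] s_def[symmetric]
    using exhaust_3[of i] exhaust_3[of j]
    by (auto simp: sum_3 matrix_matrix_mult_def algebra_simps)
  have "PB (\<lambda>z. charc k (Lax Lam lam z)) (\<lambda>z. charc k' (Lax Lam mu z)) z =
      s * trace (P ** (Q ** (M - L) - (M - L) ** Q))"
    unfolding PB_charc_left[OF phase_poly_Lax] 1 L_def[symmetric] P_def[symmetric]
    by (simp add: sum_3 trace_def matrix_matrix_mult_def[of P] algebra_simps)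
  then show ?thesis
    by (simp add: trace_commutator_eq_0 P_def Q_def charc_grad_commute)
qed

subsection \<open>Partial fractions\<close>

text \<open>Residue at lambda_a of the sum over b, c of \<open>M b c\<close> / ((lam - lambda_b)
  (lam - lambda_c)), for distinct lambda and \<open>M\<close> zero on the diagonal. The term
  \<open>b = a\<close> is a division by zero, hence 0.\<close>

definition res2 :: "real^'n::finite \<Rightarrow> ('n \<Rightarrow> 'n \<Rightarrow> complex) \<Rightarrow> 'n \<Rightarrow> complex" where
  "res2 Lam M a = (\<Sum>b\<in>UNIV. (M a b + M b a) / of_real (Lam$a - Lam$b))"

text \<open>The analogue for triple products; the three summands place \<open>a\<close> first,
  second and third.\<close>

definition res3 :: "real^'n::finite \<Rightarrow> ('n \<Rightarrow> 'n \<Rightarrow> 'n \<Rightarrow> complex) \<Rightarrow> 'n \<Rightarrow> complex" where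
  "res3 Lam T a = (\<Sum>b\<in>UNIV. \<Sum>c\<in>UNIV. (T a b c + T b a c + T b c a) /
     (of_real (Lam$a - Lam$b) * of_real (Lam$a - Lam$c)))"

text \<open>The two sums are divided differences of \<open>f\<close>; on coincident indices the quotients are 0.\<close>
lemma sum_res2:
  "(\<Sum>a\<in>UNIV. f a * res2 Lam M a) =
    (\<Sum>a\<in>UNIV. \<Sum>b\<in>UNIV. M a b * ((f a - f b) / of_real (Lam$a - Lam$b)))"
proof -
  have "(\<Sum>a\<in>UNIV. f a * res2 Lam M a) =
      (\<Sum>a\<in>UNIV. \<Sum>b\<in>UNIV. M a b * (f a / of_real (Lam$a - Lam$b))) +
      (\<Sum>a\<in>UNIV. \<Sum>b\<in>UNIV. M b a * (f a / of_real (Lam$a - Lam$b)))"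
    unfolding res2_def sum_distrib_left sum.distrib[symmetric]
    by (intro sum.cong refl) (simp add: algebra_simps add_divide_distrib)
  also have "(\<Sum>a\<in>UNIV. \<Sum>b\<in>UNIV. M b a * (f a / of_real (Lam$a - Lam$b))) =
      (\<Sum>a\<in>UNIV. \<Sum>b\<in>UNIV. M a b * (f b / of_real (Lam$b - Lam$a)))"
    by (rule sum.swap)
  finally have *: "(\<Sum>a\<in>UNIV. f a * res2 Lam M a) =
      (\<Sum>a\<in>UNIV. \<Sum>b\<in>UNIV. M a b * (f a / of_real (Lam$a - Lam$b)) +
         M a b * (f b / of_real (Lam$b - Lam$a)))"
    by (simp add: sum.distrib)
  have "f b / of_real (Lam$b - Lam$a) = - (f b / complex_of_real (Lam$a - Lam$b))" for a b
    by (metis minus_diff_eq minus_divide_right of_real_minus)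
  then show ?thesis
    unfolding * by (simp add: right_diff_distrib diff_divide_distrib del: of_real_diff)
qed

lemma sum_res3:
  "(\<Sum>a\<in>UNIV. f a * res3 Lam T a) =
    (\<Sum>a\<in>UNIV. \<Sum>b\<in>UNIV. \<Sum>c\<in>UNIV. T a b c *
      (f a / (of_real (Lam$a - Lam$b) * of_real (Lam$a - Lam$c)) +
       f b / (of_real (Lam$b - Lam$a) * of_real (Lam$b - Lam$c)) +
       f c / (of_real (Lam$c - Lam$a) * of_real (Lam$c - Lam$b))))"
proof -
  define D where "D a b c = f a / (of_real (Lam$a - Lam$b) * of_real (Lam$a - Lam$c))" for a b c
  have "(\<Sum>a\<in>UNIV. f a * res3 Lam T a) =
      (\<Sum>a\<in>UNIV. \<Sum>b\<in>UNIV. \<Sum>c\<in>UNIV. T a b c * D a b c) +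
      (\<Sum>a\<in>UNIV. \<Sum>b\<in>UNIV. \<Sum>c\<in>UNIV. T b a c * D a b c) +
      (\<Sum>a\<in>UNIV. \<Sum>b\<in>UNIV. \<Sum>c\<in>UNIV. T b c a * D a b c)"
    unfolding res3_def sum_distrib_left sum.distrib[symmetric] D_def
    by (intro sum.cong refl) (simp add: algebra_simps add_divide_distrib)
  also have "(\<Sum>a\<in>UNIV. \<Sum>b\<in>UNIV. \<Sum>c\<in>UNIV. T b a c * D a b c) =
      (\<Sum>a\<in>UNIV. \<Sum>b\<in>UNIV. \<Sum>c\<in>UNIV. T a b c * D b a c)"
    by (rule sum.swap)
  also have "(\<Sum>a\<in>UNIV. \<Sum>b\<in>UNIV. \<Sum>c\<in>UNIV. T b c a * D a b c) =
      (\<Sum>b\<in>UNIV. \<Sum>a\<in>UNIV. \<Sum>c\<in>UNIV. T b c a * D a b c)"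
    by (rule sum.swap)
  also have "\<dots> = (\<Sum>b\<in>UNIV. \<Sum>c\<in>UNIV. \<Sum>a\<in>UNIV. T b c a * D a b c)"
    by (intro sum.cong refl sum.swap)
  finally show ?thesis
    unfolding sum.distrib[symmetric] D_def by (simp add: algebra_simps)
qed

section \<open>Simple-pole expansion of the characteristic coefficients\<close>

text \<open>A principal minor polarised between the residues at \<open>a\<close> and
  \<open>b\<close>. For \<open>a = b\<close> it is a minor of a rank one matrix and
  vanishes.\<close>

definition minor2 :: "3 \<Rightarrow> 3 \<Rightarrow> 'n::finite \<Rightarrow> 'n \<Rightarrow> complex^'n^3 \<Rightarrow> complex" where
  "minor2 i j a b z = (z$i$a * cnj (z$i$a)) * (z$j$b * cnj (z$j$b))
     - (z$i$a * cnj (z$j$a)) * (z$j$b * cnj (z$i$b))"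

text \<open>The first-order part of p_k around \<open>Cmat\<close>: the coefficients are those of
  the gradient of \<open>charc k\<close> at diag(1, -1, 0).\<close>

definition quadratic :: "nat \<Rightarrow> 'n::finite \<Rightarrow> complex^'n^3 \<Rightarrow> complex" where
  "quadratic k a z = (if k = 1 then z$1$a * cnj (z$1$a) + z$2$a * cnj (z$2$a) + z$3$a * cnj (z$3$a)
     else if k = 2 then z$2$a * cnj (z$2$a) - z$1$a * cnj (z$1$a)
     else - (z$3$a * cnj (z$3$a)))"

definition quartic :: "nat \<Rightarrow> 'n::finite \<Rightarrow> 'n \<Rightarrow> complex^'n^3 \<Rightarrow> complex" where
  "quartic k a b z = (if k = 1 then 0
     else if k = 2 then minor2 1 2 a b z + minor2 1 3 a b z + minor2 2 3 a b z
     else minor2 2 3 a b z - minor2 1 3 a b z)"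

text \<open>Row-wise expansion of the determinant, with row 1 from site \<open>a\<close>, row 2 from
  \<open>b\<close> and row 3 from \<open>c\<close>. The last factor is the determinant with rows
  F_a^*, F_b^*, F_c^*, which vanishes when two sites coincide.\<close>

definition sextic :: "nat \<Rightarrow> 'n::finite \<Rightarrow> 'n \<Rightarrow> 'n \<Rightarrow> complex^'n^3 \<Rightarrow> complex" where
  "sextic k a b c z = (if k = 1 \<or> k = 2 then 0 else z$1$a * z$2$b * z$3$c *
     (cnj (z$1$a) * (cnj (z$2$b) * cnj (z$3$c) - cnj (z$3$b) * cnj (z$2$c))
    - cnj (z$2$a) * (cnj (z$1$b) * cnj (z$3$c) - cnj (z$3$b) * cnj (z$1$c))
    + cnj (z$3$a) * (cnj (z$1$b) * cnj (z$2$c) - cnj (z$2$b) * cnj (z$1$c))))"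

definition residue_fn :: "real^'n::finite \<Rightarrow> nat \<Rightarrow> 'n \<Rightarrow> complex^'n^3 \<Rightarrow> complex" where
  "residue_fn Lam k a z = quadratic k a z + res2 Lam (\<lambda>a b. quartic k a b z) a
     + res3 Lam (\<lambda>a b c. sextic k a b c z) a"

lemma quartic_diag: "quartic k a a z = 0"
  by (simp add: quartic_def minor2_def)

lemma sextic_diag: "sextic k a a c z = 0" "sextic k a b a z = 0" "sextic k a b b z = 0"
  by (simp_all add: sextic_def algebra_simps)

lemma phase_poly_minor2 [simp, intro]: "phase_poly (minor2 i j a b)"
  unfolding minor2_def[abs_def] by auto

lemma phase_poly_quadratic [simp, intro]: "phase_poly (quadratic k a)"
  unfolding quadratic_def[abs_def] by auto

lemma phase_poly_quartic [simp, intro]: "phase_poly (\<lambda>z. quartic k a b z)"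
  unfolding quartic_def[abs_def] by auto

lemma phase_poly_sextic [simp, intro]: "phase_poly (\<lambda>z. sextic k a b c z)"
  unfolding sextic_def[abs_def] by auto

lemma phase_poly_residue_fn [simp, intro]: "phase_poly (residue_fn Lam k a)"
  unfolding residue_fn_def[abs_def] res2_def res3_def by auto

lemma moment_mult:
  "moment f i j z * moment g k l z =
    (\<Sum>a\<in>UNIV. \<Sum>b\<in>UNIV. f a * g b * ((z$i$a * cnj (z$j$a)) * (z$k$b * cnj (z$l$b))))"
  unfolding moment_def sum_product by (intro sum.cong refl) simp

lemma moment_mult3:
  "moment f i j z * moment g k l z * moment h p q z =
    (\<Sum>a\<in>UNIV. \<Sum>b\<in>UNIV. \<Sum>c\<in>UNIV. f a * g b * h c *
      ((z$i$a * cnj (z$j$a)) * (z$k$b * cnj (z$l$b)) * (z$p$c * cnj (z$q$c))))"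
  unfolding moment_mult unfolding moment_def sum_distrib_right unfolding sum_distrib_left
  by (intro sum.cong refl) simp

lemma sum_minor2:
  "(\<Sum>a\<in>UNIV. \<Sum>b\<in>UNIV. f a * g b * minor2 i j a b z) =
    moment f i i z * moment g j j z - moment f i j z * moment g j i z"
  unfolding moment_mult minor2_def by (simp add: sum_subtractf[symmetric] algebra_simps)

lemma sum_quadratic:
  "(\<Sum>a\<in>UNIV. f a * quadratic k a z) =
    (if k = 1 then moment f 1 1 z + moment f 2 2 z + moment f 3 3 z
     else if k = 2 then moment f 2 2 z - moment f 1 1 z else - moment f 3 3 z)"
  by (simp add: quadratic_def moment_def sum.distrib sum_subtractf sum_negf algebra_simps)

lemma sum_quartic:
  "(\<Sum>a\<in>UNIV. \<Sum>b\<in>UNIV. f a * g b * quartic k a b z) =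
    (let M = (\<lambda>i j. moment f i i z * moment g j j z - moment f i j z * moment g j i z)
     in if k = 1 then 0 else if k = 2 then M 1 2 + M 1 3 + M 2 3 else M 2 3 - M 1 3)"
  unfolding sum_minor2[symmetric] Let_def
  by (simp add: quartic_def sum.distrib[symmetric] sum_subtractf[symmetric] algebra_simps)

text \<open>The elementary symmetric functions of 1, -1, 0, that is,
  \<open>charc k Cmat\<close>.\<close>

definition charc_C :: "nat \<Rightarrow> complex" where
  "charc_C k = (if k = 2 then -1 else 0)"

lemma charc_C_plus_moment:
  fixes f :: "'n::finite \<Rightarrow> complex"
  shows "charc k (Cmat + (\<chi> i j. moment f i j z)) = charc_C k + (\<Sum>a\<in>UNIV. f a * quadratic k a z)
    + (\<Sum>a\<in>UNIV. \<Sum>b\<in>UNIV. f a * f b * quartic k a b z)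
    + (\<Sum>a\<in>UNIV. \<Sum>b\<in>UNIV. \<Sum>c\<in>UNIV. f a * f b * f c * sextic k a b c z)"
proof -
  let ?m = "\<lambda>i j. moment f i j z"
  consider "k = 1" | "k = 2" | "k \<noteq> 1" "k \<noteq> 2" by auto
  then show ?thesis
  proof cases
    case 1
    then show ?thesis unfolding sum_quadratic sum_quartic
      by (simp add: charc_def charc_C_def trace_def sum_3 Cmat_def sextic_def)
  next
    case 2
    then show ?thesis unfolding sum_quadratic sum_quartic
      by (simp add: charc_def charc_C_def Cmat_def sextic_def algebra_simps)
  next
    case 3
    have q3: "(\<Sum>a\<in>UNIV. \<Sum>b\<in>UNIV. \<Sum>c\<in>UNIV. f a * f b * f c * sextic k a b c z) =
       ?m 1 1 * ?m 2 2 * ?m 3 3 - ?m 1 1 * ?m 2 3 * ?m 3 2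
       - (?m 1 2 * ?m 2 1 * ?m 3 3 - ?m 1 2 * ?m 2 3 * ?m 3 1)
       + (?m 1 3 * ?m 2 1 * ?m 3 2 - ?m 1 3 * ?m 2 2 * ?m 3 1)"
      unfolding moment_mult3 sum_subtractf[symmetric] sum.distrib[symmetric] using 3
      by (intro sum.cong refl) (simp add: sextic_def algebra_simps)
    show ?thesis unfolding sum_quadratic sum_quartic q3 using 3
      by (simp add: charc_def charc_C_def Cmat_def det_3 algebra_simps)
  qed
qed

text \<open>The poles are simple because the residues of the Lax matrix have rank one.\<close>
lemma charc_Lax:
  fixes Lam :: "real^'n::finite"
  assumes inj: "inj (\<lambda>a. Lam $ a)" and lam: "lam \<notin> range (\<lambda>a. of_real (Lam$a))"
  shows "charc k (Lax Lam lam z) =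
    charc_C k + (\<Sum>a\<in>UNIV. 1 / (lam - of_real (Lam$a)) * residue_fn Lam k a z)"
proof -
  define w where "w a = 1 / (lam - of_real (Lam$a))" for a
  have nz: "lam - of_real (Lam$a) \<noteq> 0" for a using lam by auto
  have ne: "complex_of_real (Lam$a) - of_real (Lam$b) \<noteq> 0" if "a \<noteq> b" for a b
    using inj that by (auto dest: injD)
  \<comment> \<open>Divided differences of the pole function over two and three nodes are the
    products of its values there, up to a sign that is + in both cases here.\<close>
  have w2: "(w a - w b) / of_real (Lam$a - Lam$b) = w a * w b" if "a \<noteq> b" for a b
    using ne[OF that] nz[of a] nz[of b] by (simp add: w_def divide_simps)
  have w3: "w a / (of_real (Lam$a - Lam$b) * of_real (Lam$a - Lam$c)) +
       w b / (of_real (Lam$b - Lam$a) * of_real (Lam$b - Lam$c)) +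
       w c / (of_real (Lam$c - Lam$a) * of_real (Lam$c - Lam$b)) = w a * w b * w c"
    if "a \<noteq> b" "a \<noteq> c" "b \<noteq> c" for a b c
    using ne[of a b] ne[of b a] ne[of a c] ne[of c a] ne[of b c] ne[of c b] that nz[of a] nz[of b] nz[of c]
    by (simp add: w_def divide_simps) (simp add: algebra_simps)
  have "Lax Lam lam z = Cmat + (\<chi> i j. moment w i j z)"
    by (simp add: vec_eq_iff Lax_nth w_def[abs_def])
  then have "charc k (Lax Lam lam z) = charc_C k + (\<Sum>a\<in>UNIV. w a * quadratic k a z)
    + (\<Sum>a\<in>UNIV. \<Sum>b\<in>UNIV. w a * w b * quartic k a b z)
    + (\<Sum>a\<in>UNIV. \<Sum>b\<in>UNIV. \<Sum>c\<in>UNIV. w a * w b * w c * sextic k a b c z)"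
    by (simp only: charc_C_plus_moment)
  also have "(\<Sum>a\<in>UNIV. \<Sum>b\<in>UNIV. w a * w b * quartic k a b z) =
      (\<Sum>a\<in>UNIV. w a * res2 Lam (\<lambda>a b. quartic k a b z) a)"
    unfolding sum_res2
  proof (intro sum.cong refl)
    fix a b
    show "w a * w b * quartic k a b z =
      quartic k a b z * ((w a - w b) / complex_of_real (Lam$a - Lam$b))"
      by (cases "a = b") (simp_all add: quartic_diag w2 del: of_real_diff)
  qed
  also have "(\<Sum>a\<in>UNIV. \<Sum>b\<in>UNIV. \<Sum>c\<in>UNIV. w a * w b * w c * sextic k a b c z) =
      (\<Sum>a\<in>UNIV. w a * res3 Lam (\<lambda>a b c. sextic k a b c z) a)"
    unfolding sum_res3
  proof (intro sum.cong refl)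
    fix a b c
    show "w a * w b * w c * sextic k a b c z = sextic k a b c z *
      (w a / (complex_of_real (Lam$a - Lam$b) * of_real (Lam$a - Lam$c)) +
       w b / (of_real (Lam$b - Lam$a) * of_real (Lam$b - Lam$c)) +
       w c / (of_real (Lam$c - Lam$a) * of_real (Lam$c - Lam$b)))"
      by (cases "a = b \<or> a = c \<or> b = c") (auto simp: sextic_diag w3 simp del: of_real_diff)
  qed
  finally show ?thesis
    by (simp add: w_def residue_fn_def distrib_left sum.distrib)
qed

text \<open>Multiplying by the distance of \<open>lam\<close> to the pole and letting
  \<open>lam\<close> tend to it isolates \<open>X a\<close>. A finite exceptional set
  \<open>S\<close> misses some punctured neighbourhood of the pole, even if it contains the pole
  itself.\<close>

lemma partial_fractions_unique:
  fixes Lam :: "real^'n::finite" and X :: "'n \<Rightarrow> complex"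
  assumes inj: "inj (\<lambda>a. Lam $ a)" and "finite S"
    and eq0: "\<And>lam. lam \<notin> S \<Longrightarrow> c + (\<Sum>a\<in>UNIV. 1 / (lam - of_real (Lam$a)) * X a) = 0"
  shows "X a = 0"
proof -
  let ?p = "complex_of_real (Lam$a)"
  have ne: "?p - of_real (Lam$b) \<noteq> 0" if "a \<noteq> b" for b
    using inj that by (auto dest: injD)
  let ?g = "\<lambda>lam. (lam - ?p) * c + X a + (\<Sum>b\<in>UNIV - {a}. (lam - ?p) / (lam - of_real (Lam$b)) * X b)"
  have "(?g \<longlongrightarrow> (?p - ?p) * c + X a + (\<Sum>b\<in>UNIV - {a}. (?p - ?p) / (?p - of_real (Lam$b)) * X b)) (at ?p)"
    using ne by (intro tendsto_intros) auto
  then have 1: "(?g \<longlongrightarrow> X a) (at ?p)" by simp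
  have "open (- (S - {?p}))" using \<open>finite S\<close> by (intro open_Compl finite_imp_closed) auto
  then have "\<forall>\<^sub>F lam in at ?p. lam \<in> - (S - {?p})" by (intro eventually_at_in_open') auto
  then have "\<forall>\<^sub>F lam in at ?p. ?g lam = 0"
    using eventually_neq_at_within[of ?p]
  proof eventually_elim
    case (elim lam)
    have "?g lam = (lam - ?p) * (c + (\<Sum>b\<in>UNIV. 1 / (lam - of_real (Lam$b)) * X b))"
      using elim by (subst sum.remove[of UNIV a]) (auto simp: distrib_left sum_distrib_left)
    with eq0[of lam] elim show ?case by simp
  qed
  then have "(?g \<longlongrightarrow> 0) (at ?p)" by (rule tendsto_eventually)
  with 1 show ?thesis by (rule tendsto_unique[rotated]) simp
qed

text \<open>Uniqueness of partial fractions is applied in each spectral parameter in turn, starting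
  from the commuting p_k.\<close>

lemma PB_residue_fn:
  fixes Lam :: "real^'n::finite"
  assumes inj: "inj (\<lambda>a. Lam $ a)"
  shows "PB (residue_fn Lam k a) (residue_fn Lam k' b) z = 0"
proof -
  let ?S = "range (\<lambda>a. complex_of_real (Lam$a))"
  \<comment> \<open>The bracket takes functions of \<open>z\<close> as arguments, so the expansion
    is needed as an equation between functions.\<close>
  note charc_Lax = ext[OF charc_Lax[OF inj]]
  have 1: "PB (residue_fn Lam k a) (\<lambda>z. charc k' (Lax Lam mu z)) z = 0" if mu: "mu \<notin> ?S" for mu a
  \<comment> \<open>\<open>mu\<close> joins the exceptional set because \<open>PB_charc_Lax\<close>
    compares distinct parameters.\<close>
  proof (rule partial_fractions_unique[OF inj, of "insert mu ?S" 0])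
    fix lam assume l: "lam \<notin> insert mu ?S"
    have "PB (\<lambda>z. charc k (Lax Lam lam z)) (\<lambda>z. charc k' (Lax Lam mu z)) z = 0"
      using l mu by (intro PB_charc_Lax) auto
    then show "0 + (\<Sum>a\<in>UNIV. 1 / (lam - of_real (Lam$a)) *
        PB (residue_fn Lam k a) (\<lambda>z. charc k' (Lax Lam mu z)) z) = 0"
      using l by (subst (asm) charc_Lax) (auto simp: PB_left)
  qed auto
  show ?thesis
  proof (rule partial_fractions_unique[OF inj, of ?S 0])
    fix mu assume mu: "mu \<notin> ?S"
    show "0 + (\<Sum>b\<in>UNIV. 1 / (mu - of_real (Lam$b)) * PB (residue_fn Lam k a) (residue_fn Lam k' b) z) = 0"
      using 1[OF mu, of a] mu by (subst (asm) charc_Lax) (auto simp: PB_right)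
  qed auto
qed

subsection \<open>Laurent coefficients and the Hamiltonians\<close>

text \<open>In \<open>x = 1 / lam\<close> the difference is a power series that vanishes on a
  punctured disc. Its constant term is 0 by a limit at 0, and dividing by \<open>x\<close> shifts
  the series, so induction reaches every coefficient.\<close>

lemma laurent_coeffs_unique:
  fixes c d :: "nat \<Rightarrow> complex"
  assumes c: "\<And>lam. r < cmod lam \<Longrightarrow> (\<lambda>n. c n / lam ^ n) sums f lam"
    and d: "\<And>lam. r < cmod lam \<Longrightarrow> (\<lambda>n. d n / lam ^ n) sums f lam"
  shows "c = d"
proof -
  \<comment> \<open>With this radius, \<open>norm x < s\<close> forces \<open>cmod (1 / x)\<close>
    above \<open>r\<close> for either sign of \<open>r\<close>.\<close>
  define s where "s = 1 / (\<bar>r\<bar> + 1)"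
  have s: "s > 0" by (simp add: s_def)
  have zero0: "e 0 = 0"
    if e: "\<And>x. x \<noteq> 0 \<Longrightarrow> norm x < s \<Longrightarrow> (\<lambda>n. e n * x ^ n) sums 0" for e :: "nat \<Rightarrow> complex"
  proof -
    \<comment> \<open>Setting the value at 0 to \<open>e 0\<close> makes \<open>g\<close> the sum of
      the series on the whole disc.\<close>
    define g where "g x = (if x = 0 then e 0 else 0)" for x :: complex
    have "(\<lambda>n. e n * x ^ n) sums g x" if x: "norm x < s" for x
      using e[of x] powser_sums_zero[of e] x by (auto simp: g_def)
    from powser_limit_0[OF s this] have "(g \<longlongrightarrow> e 0) (at 0)" .
    moreover have "(g \<longlongrightarrow> 0) (at 0)"
      by (rule tendsto_eventually) (auto simp: g_def eventually_at_filter)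
    ultimately show ?thesis by (rule tendsto_unique[rotated]) simp
  qed
  have zero: "e m = 0"
    if "\<And>x. x \<noteq> 0 \<Longrightarrow> norm x < s \<Longrightarrow> (\<lambda>n. e n * x ^ n) sums 0" for e :: "nat \<Rightarrow> complex" and m
    using that
  proof (induction m arbitrary: e)
    case (0 e)
    then show ?case by (rule zero0)
  next
    case (Suc m e)
    have e0: "e 0 = 0" by (rule zero0[OF Suc.prems])
    show ?case
    proof (rule Suc.IH)
      fix x :: complex assume x: "x \<noteq> 0" "norm x < s"
      have "(\<lambda>n. e (Suc n) * x ^ Suc n) sums 0"
        using Suc.prems[OF x] e0 by (subst sums_Suc_iff) simp
      from sums_mult[OF this, of "1 / x"] x show "(\<lambda>n. e (Suc n) * x ^ n) sums 0" by simp
    qed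
  qed
  have "c m - d m = 0" for m
  proof (rule zero)
    fix x :: complex assume x: "x \<noteq> 0" "norm x < s"
    then have "\<bar>r\<bar> + 1 < 1 / cmod x" by (simp add: s_def field_simps)
    then have "r < cmod (1 / x)" by (simp add: norm_divide)
    from sums_diff[OF c[OF this] d[OF this]] x show "(\<lambda>n. (c n - d n) * x ^ n) sums 0"
      by (simp add: power_one_over field_simps)
  qed
  then show ?thesis by auto
qed

definition power_sum_res :: "real^'n::finite \<Rightarrow> nat \<Rightarrow> nat \<Rightarrow> complex^'n^3 \<Rightarrow> complex" where
  "power_sum_res Lam k m z = (\<Sum>a\<in>UNIV. of_real (Lam$a ^ m) * residue_fn Lam k a z)"

lemma Ecoef_eq:
  fixes Lam :: "real^'n::finite"
  assumes inj: "inj (\<lambda>a. Lam $ a)"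
  shows "Ecoef Lam k m = power_sum_res Lam k m"
proof
  fix z
  \<comment> \<open>Position 0 holds E_{-1}, which is the constant \<open>charc_C k\<close>, so E_m
    sits at \<open>Suc m\<close>.\<close>
  define c where "c n = (case n of 0 \<Rightarrow> charc_C k | Suc m \<Rightarrow> power_sum_res Lam k m z)" for n
  have c: "(\<lambda>n. c n / lam ^ n) sums pk Lam k lam z" if lam: "Rmax Lam < cmod lam" for lam
  proof -
    have less: "cmod (of_real (Lam$a)) < cmod lam" for a
    proof -
      have "\<bar>Lam$a\<bar> \<le> Rmax Lam" unfolding Rmax_def by (intro Max_ge) auto
      with lam show ?thesis by simp
    qed
    from less have nin: "lam \<notin> range (\<lambda>a. of_real (Lam$a))" by force
    \<comment> \<open>Any one pole will do, since its modulus lies strictly below that of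
      \<open>lam\<close>.\<close>
    from less[of undefined] have [simp]: "lam \<noteq> 0" by auto
    have "(\<lambda>n. of_real (Lam$a ^ n) / lam ^ Suc n) sums (1 / (lam - of_real (Lam$a)))" for a
    proof -
      have "(\<lambda>n. (of_real (Lam$a) / lam) ^ n) sums (1 / (1 - of_real (Lam$a) / lam))"
        using less[of a] by (intro geometric_sums) (simp add: norm_divide)
      from sums_mult[OF this, of "1 / lam"] show ?thesis
        using nin by (simp add: power_divide field_simps)
    qed
    then have "(\<lambda>n. \<Sum>a\<in>UNIV. of_real (Lam$a ^ n) / lam ^ Suc n * residue_fn Lam k a z) sums
        (\<Sum>a\<in>UNIV. 1 / (lam - of_real (Lam$a)) * residue_fn Lam k a z)"
      by (intro sums_sum sums_mult2)
    then have "(\<lambda>n. c (Suc n) / lam ^ Suc n) sums (pk Lam k lam z - c 0 / lam ^ 0)"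
      by (simp add: pk_eq_charc charc_Lax[OF inj nin] c_def power_sum_res_def sum_divide_distrib)
    then show ?thesis by (subst (asm) sums_Suc_iff) simp
  qed
  have "(THE c. \<forall>lam. Rmax Lam < cmod lam \<longrightarrow> (\<lambda>n. c n / lam ^ n) sums pk Lam k lam z) = c"
    using c by (intro the_equality laurent_coeffs_unique[of "Rmax Lam" _ "\<lambda>lam. pk Lam k lam z"]) auto
  then show "Ecoef Lam k m z = power_sum_res Lam k m z"
    by (simp add: Ecoef_def c_def)
qed

lemma phase_poly_power_sum_res [simp, intro]: "phase_poly (power_sum_res Lam k m)"
  unfolding power_sum_res_def[abs_def] by auto

lemma PB_power_sum_res:
  fixes Lam :: "real^'n::finite"
  assumes "inj (\<lambda>a. Lam $ a)"
  shows "PB (power_sum_res Lam k m) (power_sum_res Lam k' m') z = 0"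
  unfolding power_sum_res_def[abs_def]
  by (subst PB_weighted_sums) (auto simp: PB_residue_fn[OF assms])

section \<open>The Hamiltonians as polynomials in the E_m\<close>

abbreviation pmom :: "real^'n::finite \<Rightarrow> nat \<Rightarrow> 3 \<Rightarrow> 3 \<Rightarrow> complex^'n^3 \<Rightarrow> complex" where
  "pmom Lam m \<equiv> moment (\<lambda>a. of_real (Lam$a ^ m))"

lemma ip_eq_pmom: "ip Lam m (z$i) (z$j) = pmom Lam m j i z"
  unfolding ip_def moment_def by (intro sum.cong refl) simp

lemma cnj_pmom: "cnj (pmom Lam m i j z) = pmom Lam m j i z"
  by (simp add: moment_def mult.commute)

lemma sqabs_pmom: "sqabs (pmom Lam m i j z) = pmom Lam m i j z * pmom Lam m j i z"
  unfolding sqabs_def by (simp only: complex_norm_square cnj_pmom)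

lemma Re_pmom_mult:
  "4 * complex_of_real (Re (pmom Lam m i j z * pmom Lam m' k l z)) =
    2 * (pmom Lam m i j z * pmom Lam m' k l z + pmom Lam m j i z * pmom Lam m' l k z)"
  using complex_add_cnj[of "pmom Lam m i j z * pmom Lam m' k l z"]
  by (simp only: complex_cnj_mult cnj_pmom) simp

lemma power_sum_res_expand:
  "power_sum_res Lam k m z = (\<Sum>a\<in>UNIV. of_real (Lam$a ^ m) * quadratic k a z)
     + (\<Sum>a\<in>UNIV. of_real (Lam$a ^ m) * res2 Lam (\<lambda>a b. quartic k a b z) a)
     + (\<Sum>a\<in>UNIV. of_real (Lam$a ^ m) * res3 Lam (\<lambda>a b c. sextic k a b c z) a)"
  by (simp add: power_sum_res_def residue_fn_def distrib_left sum.distrib)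

text \<open>The sums against \<open>res2\<close> and \<open>res3\<close> involve divided differences
  of lambda^m. Over three nodes these vanish for \<open>m\<close> = 0, 1; over two distinct nodes
  they are 0, 1 and lambda_a + lambda_b for \<open>m\<close> = 0, 1, 2. At \<open>m = 2\<close> the
  choice \<open>k = 2\<close> has no sextic part.\<close>

lemma power_sum_res_low:
  fixes Lam :: "real^'n::finite"
  assumes inj: "inj (\<lambda>a. Lam $ a)"
  shows "power_sum_res Lam k 0 z = (\<Sum>a\<in>UNIV. of_real (Lam$a ^ 0) * quadratic k a z)"
    and "power_sum_res Lam k 1 z = (\<Sum>a\<in>UNIV. of_real (Lam$a ^ 1) * quadratic k a z)
      + (\<Sum>a\<in>UNIV. \<Sum>b\<in>UNIV. of_real (Lam$a ^ 0) * of_real (Lam$b ^ 0) * quartic k a b z)"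
    and "power_sum_res Lam 2 2 z = (\<Sum>a\<in>UNIV. of_real (Lam$a ^ 2) * quadratic 2 a z)
      + (\<Sum>a\<in>UNIV. \<Sum>b\<in>UNIV. of_real (Lam$a ^ 1) * of_real (Lam$b ^ 0) * quartic 2 a b z)
      + (\<Sum>a\<in>UNIV. \<Sum>b\<in>UNIV. of_real (Lam$a ^ 0) * of_real (Lam$b ^ 1) * quartic 2 a b z)"
proof -
  have ne: "complex_of_real (Lam$a) - of_real (Lam$b) \<noteq> 0" if "a \<noteq> b" for a b
    using inj that by (auto dest: injD)
  have s0: "sextic k a b c z * (f a / (complex_of_real (Lam$a - Lam$b) * of_real (Lam$a - Lam$c)) +
       f b / (of_real (Lam$b - Lam$a) * of_real (Lam$b - Lam$c)) +
       f c / (of_real (Lam$c - Lam$a) * of_real (Lam$c - Lam$b))) = 0"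
    if f: "f = (\<lambda>a. 1) \<or> f = (\<lambda>a. of_real (Lam$a))" for f :: "'n \<Rightarrow> complex" and a b c
  proof (cases "a = b \<or> a = c \<or> b = c")
    case True
    then show ?thesis by (auto simp: sextic_diag)
  next
    case False
    then show ?thesis
      using f ne[of a b] ne[of b a] ne[of a c] ne[of c a] ne[of b c] ne[of c b]
      by (auto simp: divide_simps) (auto simp: algebra_simps)
  qed
  have q1: "quartic k a b z * ((of_real (Lam$a) - of_real (Lam$b)) / of_real (Lam$a - Lam$b)) = quartic k a b z"
    for k a b using ne[of a b] by (cases "a = b") (auto simp: quartic_diag)
  have q2: "quartic k a b z * ((of_real (Lam$a ^ 2) - of_real (Lam$b ^ 2)) / of_real (Lam$a - Lam$b)) =
      (of_real (Lam$a) + of_real (Lam$b)) * quartic k a b z"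
    for k a b using ne[of a b] by (cases "a = b") (auto simp: quartic_diag field_simps power2_eq_square)
  show "power_sum_res Lam k 0 z = (\<Sum>a\<in>UNIV. of_real (Lam$a ^ 0) * quadratic k a z)"
    unfolding power_sum_res_expand sum_res2 sum_res3 by (simp add: s0[of "\<lambda>a. 1"] del: of_real_diff)
  show "power_sum_res Lam k 1 z = (\<Sum>a\<in>UNIV. of_real (Lam$a ^ 1) * quadratic k a z)
      + (\<Sum>a\<in>UNIV. \<Sum>b\<in>UNIV. of_real (Lam$a ^ 0) * of_real (Lam$b ^ 0) * quartic k a b z)"
    unfolding power_sum_res_expand sum_res2 sum_res3 by (simp add: s0[of "\<lambda>a. of_real (Lam$a)"] q1 del: of_real_diff times_divide_eq_right)
  show "power_sum_res Lam 2 2 z = (\<Sum>a\<in>UNIV. of_real (Lam$a ^ 2) * quadratic 2 a z)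
      + (\<Sum>a\<in>UNIV. \<Sum>b\<in>UNIV. of_real (Lam$a ^ 1) * of_real (Lam$b ^ 0) * quartic 2 a b z)
      + (\<Sum>a\<in>UNIV. \<Sum>b\<in>UNIV. of_real (Lam$a ^ 0) * of_real (Lam$b ^ 1) * quartic 2 a b z)"
    unfolding power_sum_res_expand sum_res2 sum_res3 q2
    by (simp add: sextic_def distrib_right sum.distrib)
qed

text \<open>\<open>W1\<close>, \<open>W2\<close>, \<open>W3\<close> are Omega_1, Omega_2, Omega_3
  recovered linearly from the E_0; the squared moduli of inner products come out of the principal
  minors in E_1.\<close>

lemma Hamiltonians_eq:
  fixes Lam :: "real^'n::finite"
  assumes inj: "inj (\<lambda>a. Lam $ a)"
  defines "E \<equiv> power_sum_res Lam"
  defines "W1 \<equiv> \<lambda>z. (E 1 0 z + E 3 0 z - E 2 0 z) / 2"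
    and "W2 \<equiv> \<lambda>z. (E 1 0 z + E 3 0 z + E 2 0 z) / 2"
    and "W3 \<equiv> \<lambda>z. - E 3 0 z"
  shows "Hx Lam = (\<lambda>z. - E 1 1 z - E 3 1 z - E 2 0 z * E 3 0 z)"
    and "Hy Lam = (\<lambda>z. E 2 1 z - (W1 z * W2 z + W1 z * W3 z + W2 z * W3 z))"
    and "Ht Lam = (\<lambda>z. - 2 * E 2 2 z
        + (W2 z - W1 z) * (W1 z * W2 z + W1 z * W3 z + W2 z * W3 z - E 2 1 z)
        + (W1 z + W2 z - 2 * W3 z) * (W2 z * W3 z - W1 z * W3 z - E 3 1 z)
        + (E 1 0 z - E 3 0 z) * E 1 1 z)"
proof -
  note low = power_sum_res_low[OF inj, unfolded sum_quadratic sum_quartic Let_def]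
  have W: "W1 z = pmom Lam 0 1 1 z" "W2 z = pmom Lam 0 2 2 z" "W3 z = pmom Lam 0 3 3 z" for z
    by (simp_all add: W1_def W2_def W3_def E_def low)
  show "Hx Lam = (\<lambda>z. - E 1 1 z - E 3 1 z - E 2 0 z * E 3 0 z)"
    unfolding Hx_def ip_eq_pmom sqabs_pmom E_def low by (rule ext) (simp add: algebra_simps)
  show "Hy Lam = (\<lambda>z. E 2 1 z - (W1 z * W2 z + W1 z * W3 z + W2 z * W3 z))"
    unfolding Hy_def ip_eq_pmom sqabs_pmom W unfolding E_def low by (rule ext) (simp add: algebra_simps)
  show "Ht Lam = (\<lambda>z. - 2 * E 2 2 z
        + (W2 z - W1 z) * (W1 z * W2 z + W1 z * W3 z + W2 z * W3 z - E 2 1 z)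
        + (W1 z + W2 z - 2 * W3 z) * (W2 z * W3 z - W1 z * W3 z - E 3 1 z)
        + (E 1 0 z - E 3 0 z) * E 1 1 z)"
    unfolding Ht_def Omega_def ip_eq_pmom sqabs_pmom Re_pmom_mult W unfolding E_def low
    by (rule ext) (simp add: algebra_simps)
qed

lemma involution:
  fixes Lam :: "real^'n::finite"
  assumes inj: "inj (\<lambda>a. Lam $ a)"
  shows "PB (Hx Lam) (Hy Lam) z = 0" "PB (Hx Lam) (Ht Lam) z = 0" "PB (Hy Lam) (Ht Lam) z = 0"
    and "PB (Ecoef Lam k m) (Ecoef Lam k' m') z = 0"
    and "PB (Ecoef Lam k m) (Hx Lam) z = 0" "PB (Ecoef Lam k m) (Hy Lam) z = 0"
      "PB (Ecoef Lam k m) (Ht Lam) z = 0"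
  unfolding Hamiltonians_eq[OF inj] Ecoef_eq[OF inj]
  by (simp_all add: PB_left PB_right PB_power_sum_res[OF inj])

subsection \<open>Functional independence\<close>

text \<open>Hermitian symmetry relates the Lax matrices at \<open>mu\<close> and
  \<open>cnj mu\<close>, and uniqueness of partial fractions passes this to the residues. Real
  values later bound the rank of the differential by 3N.\<close>

lemma cnj_residue_fn:
  fixes Lam :: "real^'n::finite"
  assumes inj: "inj (\<lambda>a. Lam $ a)"
  shows "cnj (residue_fn Lam k a z) = residue_fn Lam k a z"
proof -
  let ?S = "range (\<lambda>a. complex_of_real (Lam$a))"
  have "residue_fn Lam k a z - cnj (residue_fn Lam k a z) = 0"
  proof (rule partial_fractions_unique[OF inj, of ?S 0])
    fix mu assume mu: "mu \<notin> ?S"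
    then have mu': "cnj mu \<notin> ?S"
      by (metis (mono_tags, lifting) complex_cnj_cnj complex_cnj_complex_of_real image_iff)
    have nth: "Lax Lam mu z $ i $ j = cnj (Lax Lam (cnj mu) z $ j $ i)" for i j
      by (simp add: Lax_nth moment_def Cmat_def mult.commute)
    have "charc k (Lax Lam mu z) = cnj (charc k (Lax Lam (cnj mu) z))"
      by (simp add: charc_def trace_def det_3 sum_3 nth)
    then show "0 + (\<Sum>a\<in>UNIV. 1 / (mu - of_real (Lam$a)) *
        (residue_fn Lam k a z - cnj (residue_fn Lam k a z))) = 0"
      by (cases "k = 2") (simp_all add: charc_Lax[OF inj mu] charc_Lax[OF inj mu'] charc_C_def
          right_diff_distrib diff_divide_distrib sum_subtractf)
  qed auto
  then show ?thesis by simp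
qed

lemma cnj_power_sum_res:
  fixes Lam :: "real^'n::finite"
  assumes "inj (\<lambda>a. Lam $ a)"
  shows "cnj (power_sum_res Lam k m z) = power_sum_res Lam k m z"
  by (simp add: power_sum_res_def cnj_residue_fn[OF assms])

lemma dd_real_valued:
  assumes "phase_poly f" "\<And>z. cnj (f z) = f z"
  shows "dd f z v = of_real (Re (dd f z v))"
proof -
  have "((\<lambda>z. cnj (f z)) has_derivative (\<lambda>v. cnj (dd f z v))) (at z)"
    by (intro has_derivative_cnj phase_poly_has_derivative assms(1))
  then have "(f has_derivative (\<lambda>v. cnj (dd f z v))) (at z)"
    using assms(2) by simp
  from dd_eq[OF this, of v] show ?thesis by (simp add: complex_eq_iff)
qed

text \<open>The homogeneity relation is differentiated in \<open>z\<close>; keeping the factor t on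
  the left avoids the exponent d - 1.\<close>

lemma dd_homogeneous:
  assumes "phase_poly f" "\<And>z. f (t *\<^sub>R z) = of_real (t ^ d) * f z"
  shows "of_real t * dd f (t *\<^sub>R z) v = of_real (t ^ d) * dd f z v"
proof -
  have "((\<lambda>z. f (t *\<^sub>R z)) has_derivative (\<lambda>v. dd f (t *\<^sub>R z) (t *\<^sub>R v))) (at z)"
    by (rule has_derivative_compose[of "\<lambda>z. t *\<^sub>R z" "\<lambda>v. t *\<^sub>R v"])
      (auto intro!: derivative_eq_intros phase_poly_has_derivative assms(1))
  moreover have "((\<lambda>z. of_real (t ^ d) * f z) has_derivative (\<lambda>v. of_real (t ^ d) * dd f z v)) (at z)"
    by (intro has_derivative_mult_right phase_poly_has_derivative assms(1))
  ultimately have "(\<lambda>v. dd f (t *\<^sub>R z) (t *\<^sub>R v)) = (\<lambda>v. of_real (t ^ d) * dd f z v)"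
    unfolding assms(2) by (rule has_derivative_unique)
  then have *: "dd f (t *\<^sub>R z) (t *\<^sub>R v) = of_real (t ^ d) * dd f z v"
    by (rule fun_cong)
  have "linear (dd f (t *\<^sub>R z))"
    using phase_poly_has_derivative[OF assms(1)] has_derivative_linear by blast
  then have "dd f (t *\<^sub>R z) (t *\<^sub>R v) = t *\<^sub>R dd f (t *\<^sub>R z) v" by (rule linear_cmul)
  with * show ?thesis by (simp only: scaleR_conv_of_real)
qed

section \<open>A maximal minor of the Jacobian and its leading part\<close>

text \<open>The equations are combined with the coefficients of the polynomial that vanishes at
  every node except lambda_a; its degree N - 1 is within the available range of
  \<open>m\<close>.\<close>

lemma vandermonde_injective:
  fixes Lam :: "real^'n::finite" and y :: "'n \<Rightarrow> complex"
  assumes inj: "inj (\<lambda>a. Lam $ a)"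
    and eq0: "\<And>m. m < CARD('n) \<Longrightarrow> (\<Sum>a\<in>UNIV. of_real (Lam$a ^ m) * y a) = 0"
  shows "y a = 0"
proof -
  define p where "p = (\<Prod>b\<in>UNIV - {a}. [:- complex_of_real (Lam$b), 1:])"
  have "degree p = CARD('n) - 1"
    unfolding p_def by (subst degree_prod_sum_eq) auto
  moreover have "CARD('n) > 0" by simp
  ultimately have deg: "degree p < CARD('n)" by simp
  have "(\<Sum>b\<in>UNIV. poly p (of_real (Lam$b)) * y b) =
      (\<Sum>b\<in>UNIV. \<Sum>i\<le>degree p. coeff p i * (of_real (Lam$b ^ i) * y b))"
    by (simp add: poly_altdef sum_distrib_right mult.assoc)
  also have "\<dots> = (\<Sum>i\<le>degree p. coeff p i * (\<Sum>b\<in>UNIV. of_real (Lam$b ^ i) * y b))"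
    by (subst sum.swap) (simp add: sum_distrib_left)
  also have "\<dots> = 0"
    using deg by (intro sum.neutral) (auto simp: eq0 simp del: of_real_power)
  also have "(\<Sum>b\<in>UNIV. poly p (of_real (Lam$b)) * y b) = poly p (of_real (Lam$a)) * y a"
  proof (subst sum.remove[of UNIV a])
    have "poly p (of_real (Lam$b)) = 0" if "b \<noteq> a" for b
      unfolding p_def poly_prod by (rule prod_zero) (use that in auto)
    then show "poly p (of_real (Lam$a)) * y a + (\<Sum>b\<in>UNIV - {a}. poly p (of_real (Lam$b)) * y b) =
        poly p (of_real (Lam$a)) * y a"
      by simp
  qed auto
  finally have "poly p (of_real (Lam$a)) = 0 \<or> y a = 0" by simp
  moreover have "poly p (of_real (Lam$a)) \<noteq> 0"
    using injD[OF inj] by (fastforce simp: p_def poly_prod)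
  ultimately show ?thesis by simp
qed

lemma bij_idx: "bij_betw (idx :: 'n::finite \<Rightarrow> nat) UNIV {..<CARD('n)}"
proof -
  obtain h :: "'n \<Rightarrow> nat" where "bij_betw h UNIV {..<CARD('n)}"
    using ex_bij_betw_finite_nat[of "UNIV :: 'n set"] by (auto simp: atLeast0LessThan)
  then show ?thesis unfolding idx_def
    by (rule someI[where P = "\<lambda>f. bij_betw f UNIV {..<CARD('n)}"])
qed

text \<open>The coefficient of |phi_ja|^2 in \<open>quadratic k a\<close>. The 3 x 3 matrix over k
  and j is invertible, which is what independence of the leading parts needs.\<close>

definition quadratic_coeff :: "nat \<Rightarrow> 3 \<Rightarrow> complex" where
  "quadratic_coeff k j = (if k = 1 then 1
     else if k = 2 then (if j = 1 then -1 else if j = 2 then 1 else 0)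
     else if j = 3 then -1 else 0)"

lemma dd_quadratic_ones:
  fixes a b :: "'n::finite"
  shows
  "dd (quadratic k a) (\<chi> j a. 1) (re_dir j b) = (if a = b then 2 * quadratic_coeff k j else 0)"
proof -
  have abs2: "dd (\<lambda>z. z$i$a * cnj (z$i$a)) (\<chi> j a. 1) (re_dir j b) = (if i = j \<and> a = b then 2 else 0)"
    for i j and a b :: 'n
    by (auto simp: dd_mult dd_coord dd_cnj_coord re_dir_def axis_def)
  have neg: "phase_poly f \<Longrightarrow> dd (\<lambda>z. - f z) z v = - dd f z v" for f and z v :: "complex^'n^3"
    using dd_mult[OF phase_poly.const[of "-1"], of f z v] by (simp add: dd_const)
  have diff: "phase_poly f \<Longrightarrow> phase_poly g \<Longrightarrow> dd (\<lambda>z. f z - g z) z v = dd f z v - dd g z v"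
    for f g and z v :: "complex^'n^3"
    using dd_add[of f "\<lambda>z. - g z" z v] by (simp add: neg)
  show ?thesis
    using exhaust_3[of j]
    by (auto simp: quadratic_def[abs_def] quadratic_coeff_def dd_add diff neg abs2)
qed

lemma dd_sum_mult:
  assumes "\<And>a. phase_poly (f a)"
  shows "dd (\<lambda>z. \<Sum>a\<in>S. c a * f a z) z v = (\<Sum>a\<in>S. c a * dd (f a) z v)"
proof -
  have "((\<lambda>z. \<Sum>a\<in>S. c a * f a z) has_derivative (\<lambda>v. \<Sum>a\<in>S. c a * dd (f a) z v)) (at z)"
    by (intro has_derivative_sum has_derivative_mult_right phase_poly_has_derivative assms)
  then show ?thesis by (rule dd_eq)
qed

text \<open>The square minor of the real Jacobian given by the 3N real-part directions. Complex
  entries keep its determinant a \<open>phase_poly\<close>.\<close>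

definition Jacobian :: "real^'n::finite \<Rightarrow> complex^'n^3 \<Rightarrow> complex^(3 \<times> 'n)^(3 \<times> 'n)" where
  "Jacobian Lam z = (\<chi> p q. dd (power_sum_res Lam (knum (fst p)) (idx (snd p))) z
     (re_dir (fst q) (snd q)))"

lemma phase_poly_det_Jacobian: "phase_poly (\<lambda>z. det (Jacobian Lam z))"
proof -
  have *: "phase_poly (\<lambda>z. Jacobian Lam z $ p $ q)" for p q
    unfolding Jacobian_def vec_lambda_beta by (rule phase_poly_dd[OF phase_poly_power_sum_res])
  show ?thesis unfolding det_def
    by (rule phase_poly_sum, rule phase_poly.mult, rule phase_poly.const, rule phase_poly_prod, rule *)
qed

text \<open>At \<open>t *\<^sub>R z\<close> the quadratic parts dominate the Jacobian as \<open>t\<close> tends to 0.\<close>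
lemma Jacobian_scaled:
  fixes Lam :: "real^'n::finite"
  shows "\<exists>A B. \<forall>t>0. \<forall>p q. Jacobian Lam (t *\<^sub>R z) $ p $ q = of_real t *
    (dd (\<lambda>z. \<Sum>a\<in>UNIV. of_real (Lam$a ^ idx (snd p)) * quadratic (knum (fst p)) a z) z
       (re_dir (fst q) (snd q)) + of_real (t ^ 2) * A p q + of_real (t ^ 4) * B p q)"
proof -
  define E2 where "E2 p z = (\<Sum>a\<in>UNIV. of_real (Lam$a ^ idx (snd p)) * quadratic (knum (fst p)) a z)"
    for p :: "3 \<times> 'n" and z
  define E4 where "E4 p z = (\<Sum>a\<in>UNIV. of_real (Lam$a ^ idx (snd p)) *
      res2 Lam (\<lambda>a b. quartic (knum (fst p)) a b z) a)" for p :: "3 \<times> 'n" and z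
  define E6 where "E6 p z = (\<Sum>a\<in>UNIV. of_real (Lam$a ^ idx (snd p)) *
      res3 Lam (\<lambda>a b c. sextic (knum (fst p)) a b c z) a)" for p :: "3 \<times> 'n" and z
  have poly: "phase_poly (E2 p)" "phase_poly (E4 p)" "phase_poly (E6 p)" for p
    unfolding E2_def E4_def E6_def res2_def res3_def by auto
  have q2: "quadratic k a (t *\<^sub>R z) = of_real (t ^ 2) * quadratic k a z" for k a t and z :: "complex^'n^3"
    by (simp add: quadratic_def scaleR_conv_of_real[where 'a=complex] power2_eq_square algebra_simps)
  have h2: "E2 p (t *\<^sub>R z) = of_real (t ^ 2) * E2 p z" for p t z
    unfolding E2_def q2 sum_distrib_left by (intro sum.cong refl) (simp add: algebra_simps)
  have q4: "quartic k a b (t *\<^sub>R z) = of_real (t ^ 4) * quartic k a b z" for k a b t and z :: "complex^'n^3"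
    by (simp add: quartic_def minor2_def scaleR_conv_of_real[where 'a=complex] eval_nat_numeral algebra_simps)
  have q6: "sextic k a b c (t *\<^sub>R z) = of_real (t ^ 6) * sextic k a b c z" for k a b c t and z :: "complex^'n^3"
    by (simp add: sextic_def scaleR_conv_of_real[where 'a=complex] eval_nat_numeral algebra_simps)
  have h4: "E4 p (t *\<^sub>R z) = of_real (t ^ 4) * E4 p z" for p t z
    unfolding E4_def res2_def q4 sum_distrib_left by (intro sum.cong refl) (simp add: algebra_simps)
  have h6: "E6 p (t *\<^sub>R z) = of_real (t ^ 6) * E6 p z" for p t z
    unfolding E6_def res3_def q6 sum_distrib_left by (intro sum.cong refl) (simp add: algebra_simps)
  show ?thesis
  proof (intro exI allI impI)
    fix t :: real and p q :: "3 \<times> 'n" assume t: "t > 0"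
    let ?v = "re_dir (fst q) (snd q)"
    \<comment> \<open>The parts of degree 2, 4, 6 have derivatives scaling like t, t^3, t^5; taking
      out one factor t leaves 1, t^2, t^4.\<close>
    have e: "of_real t * dd (E2 p) (t *\<^sub>R z) ?v = of_real (t ^ 2) * dd (E2 p) z ?v"
      "of_real t * dd (E4 p) (t *\<^sub>R z) ?v = of_real (t ^ 4) * dd (E4 p) z ?v"
      "of_real t * dd (E6 p) (t *\<^sub>R z) ?v = of_real (t ^ 6) * dd (E6 p) z ?v"
      by (rule dd_homogeneous[where f = "E2 p", OF poly(1) h2]
          dd_homogeneous[where f = "E4 p", OF poly(2) h4]
          dd_homogeneous[where f = "E6 p", OF poly(3) h6])+
    have E2_eq: "(\<lambda>z. \<Sum>a\<in>UNIV. of_real (Lam$a ^ idx (snd p)) * quadratic (knum (fst p)) a z) = E2 p"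
      by (rule ext) (simp only: E2_def)
    have "power_sum_res Lam (knum (fst p)) (idx (snd p)) = (\<lambda>z. E2 p z + E4 p z + E6 p z)"
      by (rule ext) (simp only: power_sum_res_expand E2_def E4_def E6_def)
    then have "of_real t * Jacobian Lam (t *\<^sub>R z) $ p $ q = of_real t * dd (E2 p) (t *\<^sub>R z) ?v
        + of_real t * dd (E4 p) (t *\<^sub>R z) ?v + of_real t * dd (E6 p) (t *\<^sub>R z) ?v"
      by (simp add: Jacobian_def dd_add poly algebra_simps)
    also have "\<dots> = of_real t * (of_real t *
        (dd (E2 p) z ?v + of_real (t ^ 2) * dd (E4 p) z ?v + of_real (t ^ 4) * dd (E6 p) z ?v))"
      unfolding e by (simp add: eval_nat_numeral algebra_simps)
    finally show "Jacobian Lam (t *\<^sub>R z) $ p $ q = of_real t *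
        (dd (\<lambda>z. \<Sum>a\<in>UNIV. of_real (Lam$a ^ idx (snd p)) * quadratic (knum (fst p)) a z) z ?v
         + of_real (t ^ 2) * (\<lambda>p q. dd (E4 p) z (re_dir (fst q) (snd q))) p q
         + of_real (t ^ 4) * (\<lambda>p q. dd (E6 p) z (re_dir (fst q) (snd q))) p q)"
      unfolding E2_eq using t by simp
  qed
qed

text \<open>The matrix is a Kronecker product of the Vandermonde matrix and twice the 3 x 3
  coefficient matrix. For a kernel vector, contraction over j leaves Vandermonde systems, and then
  the small system forces it to be 0.\<close>

lemma det_leading_Jacobian:
  fixes Lam :: "real^'n::finite"
  assumes inj: "inj (\<lambda>a. Lam $ a)"
  shows "det (\<chi> p q. dd (\<lambda>z. \<Sum>a\<in>UNIV. of_real (Lam$a ^ idx (snd p)) * quadratic (knum (fst p)) a z)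
    (\<chi> j a. 1) (re_dir (fst q) (snd q)) :: complex^(3 \<times> 'n)^(3 \<times> 'n)) \<noteq> 0" (is "det ?D \<noteq> 0")
proof -
  define D where "D = ?D"
  have D: "D $ p $ q = of_real (Lam$(snd q) ^ idx (snd p)) * (2 * quadratic_coeff (knum (fst p)) (fst q))" for p q
    unfolding D_def by (simp add: dd_sum_mult dd_quadratic_ones if_distrib[of "\<lambda>x. _ * x"] cong: if_cong)
  have "x = 0" if x: "D *v x = 0" for x
  proof -
    define y where "y i b = (\<Sum>j\<in>UNIV. 2 * quadratic_coeff (knum i) j * x $ (j, b))" for i :: 3 and b :: 'n
    have y0: "y i b = 0" for i b
    proof (rule vandermonde_injective[OF inj])
      fix m assume "m < CARD('n)"
      then obtain a :: 'n where a: "idx a = m"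
        using bij_idx[where 'n='n] unfolding bij_betw_def by (metis imageE lessThan_iff)
      have "0 = (D *v x) $ (i, a)" unfolding x by simp
      also have "\<dots> = (\<Sum>q\<in>UNIV \<times> UNIV. of_real (Lam$(snd q) ^ m) * (2 * quadratic_coeff (knum i) (fst q)) * x $ q)"
        unfolding matrix_vector_mult_def by (simp add: D a ) 
      also have "\<dots> = (\<Sum>j\<in>UNIV. \<Sum>b\<in>UNIV. of_real (Lam$b ^ m) * (2 * quadratic_coeff (knum i) j) * x $ (j, b))"
        by (subst sum.cartesian_product) (simp add: case_prod_beta')
      also have "\<dots> = (\<Sum>b\<in>UNIV. of_real (Lam$b ^ m) * y i b)"
        unfolding y_def by (subst sum.swap) (simp add: sum_distrib_left mult.assoc)
      finally show "(\<Sum>b\<in>UNIV. of_real (Lam$b ^ m) * y i b) = 0" by simp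
    qed
    have "x $ (j, b) = 0" for j b
      using y0[of 1 b] y0[of 2 b] y0[of 3 b] exhaust_3[of j]
      by (auto simp: y_def sum_3 quadratic_coeff_def knum_def)
    then show ?thesis by (simp add: vec_eq_iff)
  qed
  then have "inj ((*v) D)"
    by (metis (no_types, lifting) eq_iff_diff_eq_0 injI matrix_vector_mult_diff_distrib)
  then have "invertible D"
    by (simp add: matrix_left_invertible_injective[symmetric] invertible_left_inverse)
  then show ?thesis unfolding D_def by (simp add: invertible_det_nz)
qed

lemma ex_det_Jacobian_nonzero:
  fixes Lam :: "real^'n::finite"
  assumes inj: "inj (\<lambda>a. Lam $ a)"
  shows "\<exists>z. det (Jacobian Lam z) \<noteq> 0"
proof -
  let ?z = "\<chi> j a. 1 :: complex^'n^3"
  define D where "D p q = dd (\<lambda>z. \<Sum>a\<in>UNIV. of_real (Lam$a ^ idx (snd p)) * quadratic (knum (fst p)) a z)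
    ?z (re_dir (fst q) (snd q))" for p q :: "3 \<times> 'n"
  obtain A B where AB: "\<And>t p q. t > 0 \<Longrightarrow> Jacobian Lam (t *\<^sub>R ?z) $ p $ q = of_real t *
      (D p q + of_real (t ^ 2) * A p q + of_real (t ^ 4) * B p q)"
    using Jacobian_scaled[of Lam ?z] unfolding D_def by blast
  \<comment> \<open>The Jacobian at \<open>t *\<^sub>R ?z\<close> divided by t, extended to
    \<open>t = 0\<close> by its leading part.\<close>
  define K :: "real \<Rightarrow> complex^(3 \<times> 'n)^(3 \<times> 'n)" where
    "K t = (\<chi> p q. D p q + of_real (t ^ 2) * A p q + of_real (t ^ 4) * B p q)" for t
  have "((\<lambda>t. det (K t)) \<longlongrightarrow> det (K 0)) (at_right 0)"
    unfolding det_def K_def vec_lambda_beta by (intro tendsto_intros)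
  moreover have "det (K 0) \<noteq> 0"
    using det_leading_Jacobian[OF inj] by (simp add: K_def D_def)
  ultimately have "\<forall>\<^sub>F t in at_right 0. det (K t) \<noteq> 0"
    by (rule tendsto_imp_eventually_ne)
  then have "\<forall>\<^sub>F t in at_right 0. det (K t) \<noteq> 0 \<and> t > 0"
    by (intro eventually_conj eventually_at_right_less)
  then obtain t where t: "det (K t) \<noteq> 0" "t > 0"
    using eventually_happens'[of "at_right (0::real)"] trivial_limit_at_right_real by blast
  have "Jacobian Lam (t *\<^sub>R ?z) = (\<chi> p q. of_real t * K t $ p $ q)"
    by (simp add: vec_eq_iff AB[OF t(2)] K_def)
  then have "det (Jacobian Lam (t *\<^sub>R ?z)) = of_real t ^ CARD(3 \<times> 'n) * det (K t)"
    by (simp add: det_def prod.distrib sum_distrib_left mult_ac)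
  with t show ?thesis by (intro exI[of _ "t *\<^sub>R ?z"]) simp
qed

text \<open>On the segment from an arbitrary \<open>z\<close> towards \<open>z1\<close> the
  polynomial has finitely many zeros, so points with small positive parameter avoid them.\<close>

lemma nonzero_phase_poly_dense:
  fixes f :: "complex^'n::finite^3 \<Rightarrow> complex"
  assumes f: "phase_poly f" and z1: "f z1 \<noteq> 0"
  shows "open {z. f z \<noteq> 0}" "closure {z. f z \<noteq> 0} = UNIV"
proof -
  have "continuous_on UNIV f"
    using phase_poly_has_derivative[OF f] has_derivative_continuous
    by (metis continuous_at_imp_continuous_on)
  then show "open {z. f z \<noteq> 0}"
    by (intro open_Collect_neq continuous_on_const)
  show "closure {z. f z \<noteq> 0} = UNIV"
  proof (rule UNIV_eq_I[symmetric])
    fix z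
    obtain p where p: "\<And>t::real. f (z + t *\<^sub>R (z1 - z)) = poly p (of_real t)"
      using phase_poly_line[OF f] by blast
    from p[of 1] z1 have "p \<noteq> 0" by auto
    then have fin: "finite {t::real. poly p (of_real t) = 0}"
      using finite_vimageI[OF poly_roots_finite, of p complex_of_real] by (simp add: vimage_def inj_of_real)
    show "z \<in> closure {z. f z \<noteq> 0}"
      unfolding closure_approachable
    proof (intro allI impI)
      fix e :: real assume "e > 0"
      \<comment> \<open>The summand 1 keeps the quotient meaningful when
        \<open>z = z1\<close>.\<close>
      define d where "d = e / (norm (z1 - z) + 1)"
      have nn: "norm (z1 - z) + 1 > 0" by (simp add: add_nonneg_pos)
      then have "d > 0" using \<open>e > 0\<close> by (simp add: d_def)
      then have "infinite {0<..<d}" by simp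
      then obtain t where t: "t \<in> {0<..<d}" "poly p (of_real t) \<noteq> 0"
        using fin by (metis (mono_tags, lifting) finite_subset mem_Collect_eq subsetI)
      have "t * norm (z1 - z) \<le> t * (norm (z1 - z) + 1)" using t by (intro mult_left_mono) auto
      also have "\<dots> < e" using t nn by (simp add: d_def field_simps)
      finally have "dist (z + t *\<^sub>R (z1 - z)) z < e" using t by (simp add: dist_norm)
      then show "\<exists>y\<in>{z. f z \<noteq> 0}. dist y z < e" using p t by (intro bexI) auto
    qed
  qed
qed

lemma has_derivative_vec_lambda:
  fixes f :: "'p::finite \<Rightarrow> 'a::real_normed_vector \<Rightarrow> complex"
  assumes "\<And>p. (f p has_derivative f' p) (at z)"
  shows "((\<lambda>z. \<chi> p. f p z) has_derivative (\<lambda>v. \<chi> p. f' p v)) (at z)"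
proof (subst has_derivative_componentwise_within, rule ballI)
  fix i :: "complex^'p" assume "i \<in> Basis"
  then obtain p b where i: "i = axis p b" by (auto simp: Basis_vec_def)
  show "((\<lambda>z. (\<chi> p. f p z) \<bullet> i) has_derivative (\<lambda>v. (\<chi> p. f' p v) \<bullet> i)) (at z)"
    unfolding i inner_axis vec_lambda_beta by (rule has_derivative_inner_left[OF assms])
qed

text \<open>\<open>dim\<close> counts real dimensions. Real-valuedness puts the range inside a copy
  of R^{3N}; the invertible minor supplies a subspace of that dimension.\<close>

lemma Emap_derivative_rank:
  fixes Lam :: "real^'n::finite"
  assumes inj: "inj (\<lambda>a. Lam $ a)" and det: "det (Jacobian Lam z) \<noteq> 0"
  shows "\<exists>G'. (Emap Lam has_derivative G') (at z) \<and> dim (range G') = 3 * CARD('n)"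
proof -
  define e where "e p = power_sum_res Lam (knum (fst p)) (idx (snd p))" for p :: "3 \<times> 'n"
  define G' where "G' v = (\<chi> p. dd (e p) z v)" for v
  have pp: "phase_poly (e p)" for p by (simp add: e_def)
  have lin: "linear (dd (e p) z)" for p
    using phase_poly_has_derivative[OF pp] has_derivative_linear by blast
  have "Emap Lam = (\<lambda>z. \<chi> p. e p z)"
    by (rule ext) (simp add: Emap_def Ecoef_eq[OF inj] e_def)
  moreover have "((\<lambda>z. \<chi> p. e p z) has_derivative G') (at z)"
    unfolding G'_def by (intro has_derivative_vec_lambda phase_poly_has_derivative pp)
  ultimately have deriv: "(Emap Lam has_derivative G') (at z)" by simp
  define r :: "real^(3 \<times> 'n) \<Rightarrow> complex^(3 \<times> 'n)" where "r x = (\<chi> p. of_real (x $ p))" for x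
  have lin_r: "linear r" by (rule linearI) (simp_all add: r_def vec_eq_iff scaleR_conv_of_real[where 'a=complex])
  have "range G' \<subseteq> range r"
  proof
    fix w assume "w \<in> range G'"
    then obtain v where "w = G' v" by blast
    then have "w = r (\<chi> p. Re (dd (e p) z v))"
      using dd_real_valued[OF pp, of _ z v] cnj_power_sum_res[OF inj]
      by (simp add: G'_def r_def vec_eq_iff e_def)
    then show "w \<in> range r" by blast
  qed
  then have "dim (range G') \<le> dim (range r)" by (rule dim_subset)
  also have "\<dots> \<le> dim (UNIV :: (real^(3 \<times> 'n)) set)" using lin_r by (rule dim_image_le)
  finally have le: "dim (range G') \<le> CARD(3 \<times> 'n)" by simp
  \<comment> \<open>The differential on real combinations of the real-part directions.\<close>
  define T where "T x = Jacobian Lam z *v r x" for x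
  have lin_T: "linear T"
    by (rule linearI)
      (simp_all add: T_def linear_add[OF lin_r] linear_cmul[OF lin_r] matrix_vector_mult_def vec_eq_iff
        distrib_left sum.distrib scaleR_sum_right)
  have "invertible (Jacobian Lam z)" using det by (simp add: invertible_det_nz)
  then have inj_J: "inj ((*v) (Jacobian Lam z))"
    by (simp add: matrix_left_invertible_injective[symmetric] invertible_left_inverse)
  have "inj r" by (rule injI) (simp add: r_def vec_eq_iff)
  with inj_J have "inj T" unfolding T_def by (auto simp: inj_def)
  then have "dim (range T) = dim (UNIV :: (real^(3 \<times> 'n)) set)"
    by (intro dim_image_eq lin_T) (auto intro: inj_on_subset)
  moreover have "range T \<subseteq> range G'"
  proof
    fix w assume "w \<in> range T"
    then obtain x where "w = T x" by blast
    then have "w = G' (\<Sum>q\<in>UNIV. x $ q *\<^sub>R re_dir (fst q) (snd q))"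
      by (simp add: T_def G'_def r_def Jacobian_def matrix_vector_mult_def vec_eq_iff e_def[symmetric]
          linear_sum[OF lin] linear_cmul[OF lin] scaleR_conv_of_real[where 'a=complex] mult.commute)
    then show "w \<in> range G'" by blast
  qed
  then have "dim (range T) \<le> dim (range G')" by (rule dim_subset)
  ultimately show ?thesis using le deriv by (intro exI[of _ G']) auto
qed

lemma functional_independence:
  fixes Lam :: "real^'n::finite"
  assumes inj: "inj (\<lambda>a. Lam $ a)"
  shows "\<exists>S. open S \<and> closure S = UNIV \<and>
    (\<forall>z\<in>S. \<exists>G'. (Emap Lam has_derivative G') (at z) \<and> dim (range G') = 3 * CARD('n))"
proof -
  obtain z1 where z1: "det (Jacobian Lam z1) \<noteq> 0" using ex_det_Jacobian_nonzero[OF inj] by blast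
  from nonzero_phase_poly_dense[OF phase_poly_det_Jacobian z1] Emap_derivative_rank[OF inj]
  show ?thesis by (intro exI[of _ "{z. det (Jacobian Lam z) \<noteq> 0}"]) auto
qed

subsection \<open>The Davey--Stewartson I equation\<close>

lemma dd_Wirtinger:
  fixes f :: "complex^'n::finite^3 \<Rightarrow> complex"
  assumes "phase_poly f"
  shows "dd f z v = (\<Sum>j\<in>UNIV. \<Sum>a\<in>UNIV. dphi f z j a * v$j$a + dphibar f z j a * cnj (v$j$a))"
  using assms
proof induction
  case (const c)
  show ?case by (simp add: dphi_def dphibar_def dd_const)
next
  case (coord k b)
  have "(\<Sum>j\<in>UNIV. \<Sum>a\<in>UNIV. (if j = k \<and> a = b then 1 else 0) * v$j$a) = v$k$b"
    using sum_sum_delta[of k b "\<lambda>j a. v$j$a"] by (simp add: if_distrib[of "\<lambda>x. x * _"] cong: if_cong)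
  then show ?case by (simp add: dphi_coord dd_coord)
next
  case (cnj_coord k b)
  have "(\<Sum>j\<in>UNIV. \<Sum>a\<in>UNIV. (if j = k \<and> a = b then 1 else 0) * cnj (v$j$a)) = cnj (v$k$b)"
    using sum_sum_delta[of k b "\<lambda>j a. cnj (v$j$a)"] by (simp add: if_distrib[of "\<lambda>x. x * _"] cong: if_cong)
  then show ?case by (simp add: dphi_coord dd_cnj_coord)
next
  case (add f g)
  then show ?case
    by (simp add: dd_add Wirtinger_add sum.distrib algebra_simps)
next
  case (mult f g)
  then show ?case
    by (simp add: dd_mult Wirtinger_mult sum.distrib sum_distrib_left algebra_simps)
qed

lemma has_derivative_along_flow:
  assumes f: "phase_poly f" and F: "(F has_derivative F') (at p)"
  shows "((\<lambda>q. f (F q)) has_derivative (\<lambda>e. dd f (F p) (F' e))) (at p)"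
  using has_derivative_compose[OF F phase_poly_has_derivative[OF f]] .

text \<open>Hamilton's equations give the velocity and its conjugate, and the Wirtinger form of the
  chain rule assembles them into the bracket.\<close>

lemma dd_along_flow:
  fixes F :: "real \<times> real \<times> real \<Rightarrow> complex^'n::finite^3"
  assumes f: "phase_poly f" and flow: "ham_flow H e U F" and p: "p \<in> U"
    and F: "(F has_derivative F') (at p)"
  shows "dd (\<lambda>q. f (F q)) p e = PB f H (F p)"
proof -
  have c: "F' e $ j $ a = dd (\<lambda>q. F q $ j $ a) p e"
    "cnj (F' e $ j $ a) = dd (\<lambda>q. cnj (F q $ j $ a)) p e" for j a
    using dd_eq[OF has_derivative_along_flow[OF phase_poly.coord F], of j a e]
      dd_eq[OF has_derivative_along_flow[OF phase_poly.cnj_coord F], of j a e]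
    by (simp_all add: dd_coord dd_cnj_coord)
  have "\<i> * F' e $ j $ a = dphibar H (F p) j a" for j a
    using flow p unfolding ham_flow_def c(1) by blast
  moreover have "- \<i> * cnj (F' e $ j $ a) = dphi H (F p) j a" for j a
    using flow p unfolding ham_flow_def c(2) by blast
  ultimately have v: "F' e $ j $ a = - \<i> * dphibar H (F p) j a"
    "cnj (F' e $ j $ a) = \<i> * dphi H (F p) j a" for j a
    by (metis (no_types, lifting) mult.assoc mult.left_neutral i_squared minus_mult_minus mult_minus_left)+
  have "dd (\<lambda>q. f (F q)) p e = dd f (F p) (F' e)"
    by (rule dd_eq[OF has_derivative_along_flow[OF f F]])
  also have "\<dots> = PB f H (F p)"
    unfolding dd_Wirtinger[OF f] v(2) unfolding v(1) PB_def sum_distrib_left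
    by (intro sum.cong refl) (simp add: algebra_simps)
  finally show ?thesis .
qed

text \<open>The first derivative agrees with \<open>g\<close> along \<open>F\<close> throughout the
  open set \<open>U\<close>, so it may be differentiated again. This takes \<open>PB f H = g\<close>
  as an equation of functions.\<close>

lemma dd_dd_along_flow:
  fixes F :: "real \<times> real \<times> real \<Rightarrow> complex^'n::finite^3"
  assumes f: "phase_poly f" "phase_poly g" "PB f H = g" and flow: "ham_flow H e U F"
    and U: "open U" "p \<in> U" and F: "\<And>q. q \<in> U \<Longrightarrow> (F has_derivative F' q) (at q)"
  shows "dd (\<lambda>q. dd (\<lambda>q. f (F q)) q e) p e = PB g H (F p)"
proof -
  have "((\<lambda>q. g (F q)) has_derivative (\<lambda>e. dd g (F p) (F' p e))) (at p)"
    using U by (intro has_derivative_along_flow f F)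
  then have "((\<lambda>q. dd (\<lambda>q. f (F q)) q e) has_derivative (\<lambda>e. dd g (F p) (F' p e))) (at p)"
    using U dd_along_flow[OF f(1) flow _ F] f(3)
    by (rule_tac has_derivative_transform_within_open[of "\<lambda>q. g (F q)" _ _ _ U]) auto
  then have "dd (\<lambda>q. dd (\<lambda>q. f (F q)) q e) p e = dd g (F p) (F' p e)"
    by (rule dd_eq)
  also have "\<dots> = PB g H (F p)"
    using dd_along_flow[OF f(2) flow U(2) F[OF U(2)]]
      dd_eq[OF has_derivative_along_flow[OF f(2) F[OF U(2)]]] by simp
  finally show ?thesis .
qed

section \<open>Bracket identities behind the Davey--Stewartson system\<close>

lemma PB_pmom:
  "PB (pmom Lam m i j) (pmom Lam n k l) z =
    - \<i> * ((if i = l then pmom Lam (m + n) k j z else 0) - (if j = k then pmom Lam (m + n) i l z else 0))"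
  by (simp add: PB_moment power_add)

text \<open>\<open>G\<close> enters through an equation, so that the right-hand sides stay folded
  and the bracket rules for \<open>G\<close> apply to them.\<close>

lemma Hamiltonians_pmom:
  fixes Lam :: "real^'n::finite"
  assumes G: "G = pmom Lam"
  shows "Hx Lam = (\<lambda>z. - G 1 1 1 z - G 1 2 2 z - G 0 3 1 z * G 0 1 3 z + G 0 3 2 z * G 0 2 3 z)"
    and "Hy Lam = (\<lambda>z. - G 1 1 1 z + G 1 2 2 z - G 0 3 1 z * G 0 1 3 z - G 0 3 2 z * G 0 2 3 z
      - G 0 2 1 z * G 0 1 2 z)"
    and "Ht Lam = (\<lambda>z. 2 * G 2 1 1 z - 2 * G 2 2 2 z
      + 2 * (G 0 3 1 z * G 1 1 3 z + G 0 1 3 z * G 1 3 1 z)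
      + 2 * (G 0 3 2 z * G 1 2 3 z + G 0 2 3 z * G 1 3 2 z)
      + 2 * (G 0 2 1 z * G 1 1 2 z + G 0 1 2 z * G 1 2 1 z)
      + 2 * (G 0 3 3 z - G 0 1 1 z) * (G 0 3 1 z * G 0 1 3 z)
      - 2 * (G 0 3 3 z - G 0 2 2 z) * (G 0 3 2 z * G 0 2 3 z)
      - (G 0 1 1 z - G 0 2 2 z) * (G 0 2 1 z * G 0 1 2 z))"
  unfolding Hx_def Hy_def Ht_def Omega_def ip_eq_pmom sqabs_pmom Re_pmom_mult G by simp_all

text \<open>Moments close under the bracket, so both sides evaluate to polynomials in moments and
  agree by ring arithmetic. \<open>uu\<close> stands for |u|^2.\<close>

lemma DSI_bracket_identities:
  fixes Lam :: "real^'n::finite"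
  defines "G \<equiv> pmom Lam"
  defines "u \<equiv> \<lambda>z. \<i> * G 0 1 2 z"
    and "v1 \<equiv> \<lambda>z. 2 * (G 0 1 3 z * G 0 3 1 z)"
    and "v2 \<equiv> \<lambda>z. 2 * (G 0 2 3 z * G 0 3 2 z)"
    and "uu \<equiv> \<lambda>z. G 0 1 2 z * G 0 2 1 z"
  defines "ux \<equiv> \<lambda>z. - 2 * (G 0 1 3 z * G 0 3 2 z)"
    and "uy \<equiv> \<lambda>z. - 2 * G 1 1 2 z + (G 0 1 1 z - G 0 2 2 z) * G 0 1 2 z"
  shows "PB u (Hx Lam) = ux" "PB u (Hy Lam) = uy"
    and "- \<i> * PB u (Ht Lam) z = PB ux (Hx Lam) z + PB uy (Hy Lam) z + 2 * uu z * u z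
      + 2 * (v1 z + v2 z) * u z"
    and "PB v1 (Hx Lam) z - PB v1 (Hy Lam) z = - PB uu (Hx Lam) z"
    and "PB v2 (Hx Lam) z + PB v2 (Hy Lam) z = - PB uu (Hx Lam) z"
proof -
  have [simp]: "phase_poly (G m i j)" for m i j by (simp add: G_def)
  have [simp]: "PB (G m i j) (G n k l) z =
    - \<i> * ((if i = l then G (m + n) k j z else 0) - (if j = k then G (m + n) i l z else 0))"
    for m n i j k l z unfolding G_def by (rule PB_pmom)
  note H = Hamiltonians_pmom[OF G_def[THEN meta_eq_to_obj_eq]]
  note [simp] = PB_left PB_right
  show "PB u (Hx Lam) = ux"
    by (rule ext) (simp add: H u_def ux_def algebra_simps)
  show "PB u (Hy Lam) = uy"
    by (rule ext) (simp add: H u_def uy_def algebra_simps)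
  show "- \<i> * PB u (Ht Lam) z = PB ux (Hx Lam) z + PB uy (Hy Lam) z + 2 * uu z * u z
      + 2 * (v1 z + v2 z) * u z"
    by (simp add: H u_def ux_def uy_def uu_def v1_def v2_def algebra_simps)
  show "PB v1 (Hx Lam) z - PB v1 (Hy Lam) z = - PB uu (Hx Lam) z"
    by (simp add: H uu_def v1_def algebra_simps)
  show "PB v2 (Hx Lam) z + PB v2 (Hy Lam) z = - PB uu (Hx Lam) z"
    by (simp add: H uu_def v2_def algebra_simps)
qed

lemma DSI_solution:
  fixes Lam :: "real^'n::finite" and F :: "real \<times> real \<times> real \<Rightarrow> complex^'n^3"
  assumes U: "open U" and smooth: "smooth_on U F"
    and flow: "ham_flow (Hx Lam) ex U F" "ham_flow (Hy Lam) ey U F" "ham_flow (Ht Lam) et U F"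
  shows "DSI U (\<lambda>q. \<i> * ip Lam 0 (F q $ 2) (F q $ 1))
              (\<lambda>q. 2 * sqabs (ip Lam 0 (F q $ 3) (F q $ 1)))
              (\<lambda>q. 2 * sqabs (ip Lam 0 (F q $ 3) (F q $ 2)))"
proof -
  have "Ck (Suc 0) U F" using smooth unfolding smooth_on_def by blast
  then obtain F' where F': "\<And>q. q \<in> U \<Longrightarrow> (F has_derivative F' q) (at q)" by auto
  define u where "u z = \<i> * pmom Lam 0 1 2 z" for z
  define v1 where "v1 z = 2 * (pmom Lam 0 1 3 z * pmom Lam 0 3 1 z)" for z
  define v2 where "v2 z = 2 * (pmom Lam 0 2 3 z * pmom Lam 0 3 2 z)" for z
  define uu where "uu z = pmom Lam 0 1 2 z * pmom Lam 0 2 1 z" for z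
  define ux where "ux z = - 2 * (pmom Lam 0 1 3 z * pmom Lam 0 3 2 z)" for z
  define uy where "uy z = - 2 * pmom Lam 1 1 2 z +
    (pmom Lam 0 1 1 z - pmom Lam 0 2 2 z) * pmom Lam 0 1 2 z" for z
  note defs = u_def v1_def v2_def uu_def ux_def uy_def
  have poly: "phase_poly u" "phase_poly v1" "phase_poly v2" "phase_poly uu" "phase_poly ux" "phase_poly uy"
    unfolding defs[abs_def] by auto
  note ids = DSI_bracket_identities[of Lam, folded defs[abs_def]]
  \<comment> \<open>The factor i in u has modulus 1 and drops out of |u|^2.\<close>
  have sq: "sqabs (\<i> * pmom Lam 0 1 2 z) = uu z" for z
    using sqabs_pmom[of Lam 0 1 2 z] by (simp only: sqabs_def norm_mult norm_ii mult_1 uu_def)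
  show ?thesis
    unfolding DSI_def ip_eq_pmom sq unfolding sqabs_pmom unfolding defs(1-3)[symmetric]
  proof (intro ballI conjI)
    fix p assume p: "p \<in> U"
    have d: "dd (\<lambda>q. f (F q)) p ex = PB f (Hx Lam) (F p)"
      "dd (\<lambda>q. f (F q)) p ey = PB f (Hy Lam) (F p)"
      "dd (\<lambda>q. f (F q)) p et = PB f (Ht Lam) (F p)" if "phase_poly f" for f
      using dd_along_flow[OF that _ p F'[OF p]] flow by blast+
    have dxx: "dd (\<lambda>q. dd (\<lambda>q. u (F q)) q ex) p ex = PB ux (Hx Lam) (F p)"
      by (rule dd_dd_along_flow[OF poly(1,5) ids(1) flow(1) U p F'])
    have dyy: "dd (\<lambda>q. dd (\<lambda>q. u (F q)) q ey) p ey = PB uy (Hy Lam) (F p)"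
      by (rule dd_dd_along_flow[OF poly(1,6) ids(2) flow(2) U p F'])
    show "- \<i> * dd (\<lambda>q. u (F q)) p et = dd (\<lambda>q. dd (\<lambda>q. u (F q)) q ex) p ex
        + dd (\<lambda>q. dd (\<lambda>q. u (F q)) q ey) p ey + 2 * uu (F p) * u (F p) + 2 * (v1 (F p) + v2 (F p)) * u (F p)"
      unfolding d(3)[OF poly(1)] dxx dyy using ids(3)[of "F p"] by (simp only: defs)
    show "dd (\<lambda>q. v1 (F q)) p ex - dd (\<lambda>q. v1 (F q)) p ey = - dd (\<lambda>q. uu (F q)) p ex"
      unfolding d(1,2)[OF poly(2)] d(1)[OF poly(4)] by (rule ids(4))
    show "dd (\<lambda>q. v2 (F q)) p ex + dd (\<lambda>q. v2 (F q)) p ey = - dd (\<lambda>q. uu (F q)) p ex"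
      unfolding d(1,2)[OF poly(3)] d(1)[OF poly(4)] by (rule ids(5))
  qed
qed

theorem theorem1:
  fixes Lam :: "real^'n::finite"
  assumes distinct: "inj (\<lambda>a. Lam $ a)"
    and nonzero: "\<And>a. Lam $ a \<noteq> 0"
  shows
    "PB (Hx Lam) (Hy Lam) = (\<lambda>z. 0) \<and> PB (Hx Lam) (Ht Lam) = (\<lambda>z. 0) \<and>
     PB (Hy Lam) (Ht Lam) = (\<lambda>z. 0)
   \<and> (\<forall>k\<in>{1,2,3}. \<forall>k'\<in>{1,2,3}. \<forall>m<CARD('n). \<forall>m'<CARD('n).
        PB (Ecoef Lam k m) (Ecoef Lam k' m') = (\<lambda>z. 0))
   \<and> (\<forall>k\<in>{1,2,3}. \<forall>m<CARD('n).
        PB (Ecoef Lam k m) (Hx Lam) = (\<lambda>z. 0) \<and>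
        PB (Ecoef Lam k m) (Hy Lam) = (\<lambda>z. 0) \<and>
        PB (Ecoef Lam k m) (Ht Lam) = (\<lambda>z. 0))
   \<and> (\<exists>S. open S \<and> closure S = UNIV \<and>
        (\<forall>z\<in>S. \<exists>G'. (Emap Lam has_derivative G') (at z) \<and> dim (range G') = 3 * CARD('n)))
   \<and> (\<forall>U F. open U \<and> smooth_on U F \<and>
        ham_flow (Hx Lam) ex U F \<and> ham_flow (Hy Lam) ey U F \<and> ham_flow (Ht Lam) et U F \<longrightarrow>
        DSI U (\<lambda>q. \<i> * ip Lam 0 (F q $ 2) (F q $ 1))
              (\<lambda>q. 2 * sqabs (ip Lam 0 (F q $ 3) (F q $ 1)))
              (\<lambda>q. 2 * sqabs (ip Lam 0 (F q $ 3) (F q $ 2))))"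
  by (intro conjI ballI allI impI ext;
      (rule involution[OF distinct] functional_independence[OF distinct]
        | (elim conjE, rule DSI_solution; assumption)))

end
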